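(* Let $m<n$ and consider the nonlinear system $$\dot x=f(x)+g(x)u,\qquad x\in\mathbb{R}^n,\ u\in\mathbb{R}^m,$$ with $f:\mathbb{R}^n\to\mathbb{R}^n$ and $g:\mathbb{R}^n\to\mathbb{R}^{n\times m}$ smooth, $g(x)$ of full column rank for every $x$, together with the dynamic state feedback $$\dot u=\alpha u+\beta+\dot v,\qquad \alpha=-\left(g^\top g\right)^{-1}g^\top\dot g,\qquad \beta=-g^\top M\dot x .$$ Assume: (A1) $M\in\mathbb{R}^{n\times n}$ is a symmetric positive definite matrix such that $M\frac{\partial f}{\partial x}+\frac{\partial f}{\partial x}^\top M<0$ for all $x$; (A2) a full-rank left annihilator $g^{\perp}$ of $g$ satisfies $g^{\perp}\frac{\partial g}{\partial x}=0$; (A3) $Mg(x)$ is integrable. Let $\Gamma:\mathbb{R}^n\to\mathbb{R}^m$ be a function with $\dot\Gamma=(Mg)^\top\dot x$, let $y=g^\top M\dot x$, let $(x^\ast,u^\ast)$ satisfy $f(x^\ast)+g(x^\ast)u^\ast=0$, and let $k_1>0$, $k_i>0$, $k_d\ge 0$ be constants. Define $v$ by $$\dot v:=\frac{1}{k_1}\left(\dot{\bar v}-k_d\,y-k_i\left(\Gamma(x)-\Gamma(x^\ast)\right)\right).$$ Then the resulting closed-loop system is passive with port variables $\dot{\bar v}$ (input) and $y$ (output). Further, for $\dot{\bar v}=0$, the closed-loop system is stable with $x^\ast$ as the stable equilibrium point (i.e. $(x^\ast,u^\ast)$ is a stable equilibrium of the closed-loop system in the state $(x,u)$). Furthermore,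 if $y=0\implies\lim_{t\to\infty}x(t)= x^\ast$ (that is, every closed-loop trajectory with $\dot{\bar v}=0$ along which $y\equiv0$ satisfies $x(t)\to x^\ast$), then $x^\ast$ is asymptotically stable (i.e. $(x^\ast,u^\ast)$ is an asymptotically stable equilibrium of the closed-loop system).
   Context: A full-rank left annihilator of $g$ is a matrix $g^{\perp}(x)\in\mathbb{R}^{(n-m)\times n}$ of rank $n-m$ for every $x$ with $g^{\perp}(x)g(x)=0$; $g^{\perp}\frac{\partial g}{\partial x}=0$ means $g^{\perp}(x)\frac{\partial g}{\partial x_k}(x)=0$ for every $k$ and $x$. Integrability of $Mg$ means each column $w$ of $Mg$ satisfies $\frac{\partial w_i}{\partial x_k}=\frac{\partial w_k}{\partial x_i}$ for all $i,k$ on $\mathbb{R}^n$; this guarantees that $\Gamma$ with $\frac{\partial\Gamma}{\partial x}=(Mg)^\top$ exists. Here $\dot x$ stands for $f(x)+g(x)u$ and $\dot g=\sum_k\frac{\partial g}{\partial x_k}(x)\dot x_k$, so the closed loop is a system with state $(x,u)$ and external input signal $\dot{\bar v}\in\mathbb{R}^m$. Passive with input $\dot{\bar v}$ and output $y$ means: there exists a nonnegative differentiable storage function $V_d$ of the state $(x,u)$ such that $\frac{d}{dt}V_d\le y^\top\dot{\bar v}$ along all trajectories. Stability and asymptotic stability are in the (local) sense of Lyapunov. *)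

theory Defs
  imports "HOL-Analysis.Analysis"
begin

section \<open>Calculus on Euclidean spaces\<close>

primrec Ck :: "nat \<Rightarrow> ('a::euclidean_space \<Rightarrow> 'b::real_normed_vector) \<Rightarrow> bool" where
  "Ck 0 h \<longleftrightarrow> continuous_on UNIV h"
| "Ck (Suc k) h \<longleftrightarrow> (\<forall>x. h differentiable (at x)) \<and>
     (\<forall>v. Ck k (\<lambda>x. frechet_derivative h (at x) v))"

definition smooth :: "('a::euclidean_space \<Rightarrow> 'b::real_normed_vector) \<Rightarrow> bool" where
  "smooth h \<longleftrightarrow> (\<forall>k. Ck k h)"

text \<open>Only meaningful where \<open>h\<close> is differentiable, which holds for all uses below.\<close>

definition partial :: "(real^'n \<Rightarrow> 'b::real_normed_vector) \<Rightarrow> 'n \<Rightarrow> real^'n \<Rightarrow> 'b" where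
  "partial h k x = frechet_derivative h (at x) (axis k 1)"


section \<open>Matrices\<close>

definition positive_definite :: "real^'n^'n \<Rightarrow> bool" where
  "positive_definite A \<longleftrightarrow> transpose A = A \<and> (\<forall>v. v \<noteq> 0 \<longrightarrow> v \<bullet> (A *v v) > 0)"

definition negative_definite :: "real^'n^'n \<Rightarrow> bool" where
  "negative_definite A \<longleftrightarrow> positive_definite (- A)"

text \<open>\<open>real^'m^'n\<close> is the type of matrices with \<open>CARD('n)\<close> rows and \<open>CARD('m)\<close> columns.\<close>

definition full_rank_left_annihilator ::
    "(real^'n \<Rightarrow> real^'n^'k) \<Rightarrow> (real^'n \<Rightarrow> real^'m^'n) \<Rightarrow> bool" where
  "full_rank_left_annihilator gp g \<longleftrightarrow>
     CARD('k) = CARD('n) - CARD('m) \<and>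
     (\<forall>x. rank (gp x) = CARD('k) \<and> gp x ** g x = 0)"

definition columns_integrable :: "(real^'n \<Rightarrow> real^'m^'n) \<Rightarrow> bool" where
  "columns_integrable W \<longleftrightarrow> (\<forall>j x i k.
     partial (\<lambda>x. column j (W x) $ i) k x = partial (\<lambda>x. column j (W x) $ k) i x)"


section \<open>Trajectories, passivity and stability\<close>

text \<open>A time-invariant system with input is \<open>F z w\<close> (state \<open>z\<close>, input \<open>w\<close>). Time starts at 0,
  and the derivative at the left end point of the interval is one-sided.\<close>

definition trajectory ::
    "('s::real_normed_vector \<Rightarrow> 'w \<Rightarrow> 's) \<Rightarrow> real set \<Rightarrow> (real \<Rightarrow> 'w) \<Rightarrow> (real \<Rightarrow> 's) \<Rightarrow> bool" where
  "trajectory F I w z \<longleftrightarrow>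
     (\<forall>t\<in>I. (z has_vector_derivative F (z t) (w t)) (at t within I))"

text \<open>The intervals are arbitrary \<open>[0,T)\<close>, so trajectories with finite escape time are covered
  as well as those defined for all \<open>t \<ge> 0\<close>.\<close>

definition passive_system ::
    "('s::real_normed_vector \<Rightarrow> 'w::real_inner \<Rightarrow> 's) \<Rightarrow> ('s \<Rightarrow> 'w) \<Rightarrow> bool" where
  "passive_system F h \<longleftrightarrow> (\<exists>V :: 's \<Rightarrow> real.
     (\<forall>z. 0 \<le> V z) \<and> (\<forall>z. V differentiable (at z)) \<and>
     (\<forall>T>0. \<forall>w z. trajectory F {0..<T} w z \<longrightarrow>
        (\<forall>t\<in>{0..<T}. \<exists>D. ((\<lambda>s. V (z s)) has_real_derivative D) (at t within {0..<T})
                        \<and> D \<le> h (z t) \<bullet> w t)))"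

text \<open>Lyapunov stability of \<open>z' = F z 0\<close>. A trajectory exists for all \<open>t \<ge> 0\<close> from every nearby
  initial state, and every trajectory, on whatever interval \<open>[0,T)\<close>, stays close.\<close>

definition stable_equilibrium ::
    "('s::real_normed_vector \<Rightarrow> 'w::zero \<Rightarrow> 's) \<Rightarrow> 's \<Rightarrow> bool" where
  "stable_equilibrium F ze \<longleftrightarrow> F ze 0 = 0 \<and>
     (\<forall>\<epsilon>>0. \<exists>\<delta>>0. \<forall>z0. dist z0 ze < \<delta> \<longrightarrow>
        (\<exists>z. trajectory F {0..} (\<lambda>_. 0) z \<and> z 0 = z0) \<and>
        (\<forall>T>0. \<forall>z. trajectory F {0..<T} (\<lambda>_. 0) z \<and> z 0 = z0 \<longrightarrow>
           (\<forall>t\<in>{0..<T}. dist (z t) ze < \<epsilon>)))"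

definition asymptotically_stable_equilibrium ::
    "('s::real_normed_vector \<Rightarrow> 'w::zero \<Rightarrow> 's) \<Rightarrow> 's \<Rightarrow> bool" where
  "asymptotically_stable_equilibrium F ze \<longleftrightarrow> stable_equilibrium F ze \<and>
     (\<exists>\<delta>>0. \<forall>z. trajectory F {0..} (\<lambda>_. 0) z \<and> dist (z 0) ze < \<delta> \<longrightarrow> (z \<longlongrightarrow> ze) at_top)"


section \<open>The plant and the dynamic state feedback\<close>

definition xdot ::
    "(real^'n \<Rightarrow> real^'n) \<Rightarrow> (real^'n \<Rightarrow> real^'m^'n) \<Rightarrow> real^'n \<Rightarrow> real^'m \<Rightarrow> real^'n" where
  "xdot f g x u = f x + g x *v u"

definition gdot ::
    "(real^'n \<Rightarrow> real^'n) \<Rightarrow> (real^'n \<Rightarrow> real^'m^'n) \<Rightarrow> real^'n \<Rightarrow> real^'m \<Rightarrow> real^'m^'n" where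
  "gdot f g x u = (\<Sum>k\<in>UNIV. (xdot f g x u $ k) *\<^sub>R partial g k x)"

definition feedback_alpha ::
    "(real^'n \<Rightarrow> real^'n) \<Rightarrow> (real^'n \<Rightarrow> real^'m^'n) \<Rightarrow> real^'n \<Rightarrow> real^'m \<Rightarrow> real^'m^'m" where
  "feedback_alpha f g x u =
     - (matrix_inv (transpose (g x) ** g x) ** transpose (g x) ** gdot f g x u)"

definition feedback_beta ::
    "(real^'n \<Rightarrow> real^'n) \<Rightarrow> (real^'n \<Rightarrow> real^'m^'n) \<Rightarrow> real^'n^'n \<Rightarrow> real^'n \<Rightarrow> real^'m \<Rightarrow> real^'m" where
  "feedback_beta f g M x u = - (transpose (g x) *v (M *v xdot f g x u))"

fun port_output ::
    "(real^'n \<Rightarrow> real^'n) \<Rightarrow> (real^'n \<Rightarrow> real^'m^'n) \<Rightarrow> real^'n^'n \<Rightarrow>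
     (real^'n) \<times> (real^'m) \<Rightarrow> real^'m" where
  "port_output f g M (x, u) = transpose (g x) *v (M *v xdot f g x u)"

text \<open>The port input \<open>w\<close> is the signal \<open>d/dt v_bar\<close>; \<open>vdot\<close> is \<open>d/dt v\<close>. Neither \<open>v_bar\<close>
  nor \<open>v\<close> itself enters the closed loop.\<close>

definition vdot ::
    "(real^'n \<Rightarrow> real^'n) \<Rightarrow> (real^'n \<Rightarrow> real^'m^'n) \<Rightarrow> real^'n^'n \<Rightarrow> (real^'n \<Rightarrow> real^'m) \<Rightarrow>
     real^'n \<Rightarrow> real \<Rightarrow> real \<Rightarrow> real \<Rightarrow> real^'n \<Rightarrow> real^'m \<Rightarrow> real^'m \<Rightarrow> real^'m" where
  "vdot f g M \<Gamma> xs k1 ki kd x u w =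
     (1 / k1) *\<^sub>R (w - kd *\<^sub>R port_output f g M (x, u) - ki *\<^sub>R (\<Gamma> x - \<Gamma> xs))"

fun closed_loop ::
    "(real^'n \<Rightarrow> real^'n) \<Rightarrow> (real^'n \<Rightarrow> real^'m^'n) \<Rightarrow> real^'n^'n \<Rightarrow> (real^'n \<Rightarrow> real^'m) \<Rightarrow>
     real^'n \<Rightarrow> real \<Rightarrow> real \<Rightarrow> real \<Rightarrow>
     (real^'n) \<times> (real^'m) \<Rightarrow> real^'m \<Rightarrow> (real^'n) \<times> (real^'m)" where
  "closed_loop f g M \<Gamma> xs k1 ki kd (x, u) w =
     (xdot f g x u,
      feedback_alpha f g x u *v u + feedback_beta f g M x u + vdot f g M \<Gamma> xs k1 ki kd x u w)"

end

theory Submission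
  imports Defs
begin

text \<open>Write \<open>p = f x + g x u\<close>, \<open>q = \<Gamma> x - \<Gamma> xs\<close> and \<open>y = g\<^sup>T M p\<close>. Since the annihilator kills
  \<open>\<partial>g\<close>, the time derivative \<open>g'\<close> maps into the range of \<open>g\<close>, so the feedback \<open>\<alpha> u\<close> cancels
  \<open>g' u\<close> and the loop becomes
  \<open>p' = (\<partial>f/\<partial>x) p - g y + g v'\<close>, \<open>q' = y\<close>. The storage function is
  \<open>k1/2 p\<^sup>T M p + ki/2 |q|\<^sup>2\<close>. With zero input the right-hand side is linear in \<open>(p, q)\<close> with
  coefficients depending continuously on \<open>x\<close>, and adding a small multiple of the cross term
  \<open>p\<^sup>T M g(xs) q\<close> makes the storage function a strict Lyapunov function near the equilibrium:
  its derivative is negative at \<open>p = 0\<close>, \<open>q \<noteq> 0\<close>, and Finsler's lemma handles the rest. Contraction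
  also makes the derivative of \<open>(x, u) \<mapsto> (p, q)\<close> injective, so \<open>(p, q)\<close> measures the distance to the
  equilibrium.\<close>

section \<open>Solutions and Lyapunov functions\<close>

lemma integral_has_vector_derivative_atLeast:
  fixes h :: "real \<Rightarrow> 'a::banach"
  assumes "continuous_on {0..} h" "t \<ge> 0"
  shows "((\<lambda>u. integral {0..u} h) has_vector_derivative h t) (at t within {0..})"
proof -
  have "((\<lambda>u. integral {0..u} h) has_vector_derivative h t) (at t within {0..t+1})"
    using assms by (intro integral_has_vector_derivative continuous_on_subset[OF assms(1)]) auto
  moreover have "at t within {0..} = at t within {0..t+1}"
    using assms(2) by (intro at_within_nhd[of _ "{..<t+1}"]) auto
  ultimately show ?thesis by simp
qed

text \<open>Picard's theorem by a single application of the contraction principle: with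
  \<open>z t = z0 + exp (2 L t) \<phi> t\<close> the integral operator contracts the bounded continuous
  functions \<open>\<phi>\<close> by the factor \<open>1/2\<close>. Negative times are collapsed to 0.\<close>

lemma global_solution_exists:
  fixes G :: "'a::euclidean_space \<Rightarrow> 'a"
  assumes lip: "L-lipschitz_on UNIV G" and bnd: "bounded (range G)"
  obtains z where "z 0 = z0" "\<And>t. t \<ge> 0 \<Longrightarrow> (z has_vector_derivative G (z t)) (at t within {0..})"
proof -
  \<comment> \<open>\<open>L\<close> may be 0; the shift gives a positive rate, so that one can
    divide by \<open>2 * K\<close>.\<close>
  define K where "K = L + 1"
  have K: "K > 0" using lipschitz_on_nonneg[OF lip] by (simp add: K_def)
  have lipK: "norm (G x - G y) \<le> K * norm (x - y)" for x y
    using lipschitz_on_normD[OF lip, of x y] norm_ge_zero[of "x - y"]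
    by (simp add: K_def algebra_simps del: norm_ge_zero)
  have Gcont: "continuous_on UNIV G" using lip by (rule lipschitz_on_continuous_on)
  obtain B where B: "\<And>x. norm (G x) \<le> B" "B > 0"
    using bnd unfolding bounded_pos by auto
  define zf where "zf \<phi> s = z0 + exp (2 * K * s) *\<^sub>R apply_bcontfun \<phi> s" for \<phi> :: "real \<Rightarrow>\<^sub>C 'a" and s
  define I where "I \<phi> t = integral {0..t} (\<lambda>s. G (zf \<phi> s))" for \<phi> t
  \<comment> \<open>The weight is divided out again, so a fixed point of \<open>P\<close> says
    exactly that \<open>zf \<phi>\<close> solves the integral equation for nonnegative
    times.\<close>
  define P where "P \<phi> t = exp (- (2 * K * max 0 t)) *\<^sub>R I \<phi> (max 0 t)" for \<phi> t
  have zcont: "continuous_on S (zf \<phi>)" for S \<phi>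
    unfolding zf_def by (intro continuous_intros continuous_on_apply_bcontfun)
  have Gz: "continuous_on S (\<lambda>s. G (zf \<phi> s))" for S \<phi>
    using continuous_on_compose[OF zcont continuous_on_subset[OF Gcont]] by (simp add: o_def)
  have Ider: "((I \<phi>) has_vector_derivative G (zf \<phi> t)) (at t within {0..})" if "t \<ge> 0" for \<phi> t
    unfolding I_def using integral_has_vector_derivative_atLeast[OF Gz that] by simp
  have Icont: "continuous_on {0..} (I \<phi>)" for \<phi>
    by (rule continuous_on_vector_derivative[of "{0..}" _ "\<lambda>t. G (zf \<phi> t)"]) (use Ider in auto)
  have Ibnd: "norm (I \<phi> t) \<le> B * t" if "t \<ge> 0" for \<phi> t
    unfolding I_def using integral_bound[OF that Gz, of \<phi> B] B by simp
  \<comment> \<open>A bounded field makes the integral grow at most linearly, and the exponential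
    weight absorbs linear growth; hence \<open>P \<phi>\<close> is bounded.\<close>
  have expt: "exp (- (2 * K * t)) * t \<le> 1 / (2 * K)" if "t \<ge> 0" for t
  proof -
    have "2 * K * t \<le> exp (2 * K * t)" using exp_ge_add_one_self[of "2*K*t"] by linarith
    then show ?thesis using K by (simp add: exp_minus field_simps)
  qed
  have "P \<phi> \<in> bcontfun" for \<phi>
  proof (rule bcontfun_normI)
    have "continuous_on UNIV (\<lambda>t. I \<phi> (max 0 t))"
      by (rule continuous_on_compose2[OF Icont]) (auto intro!: continuous_intros)
    then show "continuous_on UNIV (P \<phi>)" unfolding P_def by (intro continuous_intros)
    fix t :: real
    have "norm (P \<phi> t) \<le> exp (- (2 * K * max 0 t)) * (B * max 0 t)"
      unfolding P_def using Ibnd[of "max 0 t" \<phi>] by simp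
    also have "\<dots> \<le> B / (2 * K)" using mult_left_mono[OF expt[of "max 0 t"], of B] B by (simp add: mult_ac)
    finally show "norm (P \<phi> t) \<le> B / (2 * K)" .
  qed
  then have appP: "apply_bcontfun (Bcontfun (P \<phi>)) = P \<phi>" for \<phi> by (simp add: Bcontfun_inverse)
  have ed: "dist (exp u *\<^sub>R x) (exp u *\<^sub>R y) = exp u * norm (x - y)" for u and x y :: 'a
    by (simp add: dist_norm scaleR_diff_right[symmetric])
  have contr: "dist (Bcontfun (P \<phi>)) (Bcontfun (P \<psi>)) \<le> 1/2 * dist \<phi> \<psi>" for \<phi> \<psi>
  proof (rule dist_bound)
    fix t :: real
    define s where "s = max 0 t"
    have s: "s \<ge> 0" by (simp add: s_def)
    define d where "d = dist \<phi> \<psi>"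
    have d: "norm (apply_bcontfun \<phi> r - apply_bcontfun \<psi> r) \<le> d" for r
      using dist_bounded[of \<phi> r \<psi>] by (simp add: d_def dist_norm)
    have "I \<phi> s - I \<psi> s = integral {0..s} (\<lambda>r. G (zf \<phi> r) - G (zf \<psi> r))"
      unfolding I_def by (intro integral_diff[symmetric] integrable_continuous_real Gz)
    also have "norm \<dots> \<le> integral {0..s} (\<lambda>r. K * d * exp (2 * K * r))"
    proof (rule integral_norm_bound_integral)
      show "(\<lambda>r. G (zf \<phi> r) - G (zf \<psi> r)) integrable_on {0..s}"
        by (intro integrable_continuous_real continuous_intros Gz)
      show "(\<lambda>r. K * d * exp (2 * K * r)) integrable_on {0..s}"
        by (intro integrable_continuous_real continuous_intros)
      fix r assume "r \<in> {0..s}"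
      have "norm (G (zf \<phi> r) - G (zf \<psi> r)) \<le> K * norm (zf \<phi> r - zf \<psi> r)" by (rule lipK)
      also have "zf \<phi> r - zf \<psi> r = exp (2 * K * r) *\<^sub>R (apply_bcontfun \<phi> r - apply_bcontfun \<psi> r)"
        by (simp add: zf_def algebra_simps)
      also have "K * norm \<dots> \<le> K * (exp (2 * K * r) * d)"
        using K d[of r] by (intro mult_left_mono) auto
      finally show "norm (G (zf \<phi> r) - G (zf \<psi> r)) \<le> K * d * exp (2 * K * r)" by (simp add: mult_ac)
    qed
    \<comment> \<open>Integrating the weight produces \<open>1 / (2 * K)\<close>, which turns the
      Lipschitz factor \<open>K\<close> into the contraction factor \<open>1/2\<close>.\<close>
    also have "\<dots> = d / 2 * exp (2 * K * s) - d / 2 * exp (2 * K * 0)"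
      using K s by (intro integral_unique fundamental_theorem_of_calculus)
        (auto intro!: derivative_eq_intros simp: has_real_derivative_iff_has_vector_derivative[symmetric])
    also have "\<dots> \<le> d / 2 * exp (2 * K * s)" by (simp add: d_def)
    finally have "norm (I \<phi> s - I \<psi> s) \<le> d / 2 * exp (2 * K * s)" .
    then have "exp (- (2 * K * s)) * norm (I \<phi> s - I \<psi> s) \<le> d / 2"
      using K by (simp add: exp_minus field_simps)
    then show "dist (apply_bcontfun (Bcontfun (P \<phi>)) t) (apply_bcontfun (Bcontfun (P \<psi>)) t) \<le> 1/2 * dist \<phi> \<psi>"
      unfolding d_def[symmetric] appP P_def s_def[symmetric] by (simp add: ed)
  qed
  have "\<exists>!\<phi>. Bcontfun (P \<phi>) = \<phi>"
    by (rule banach_fix_type[of "1/2"]) (use contr in auto)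
  then obtain \<phi> where "Bcontfun (P \<phi>) = \<phi>" by blast
  then have fixed: "apply_bcontfun \<phi> = P \<phi>" by (metis appP)
  have zI: "zf \<phi> t = z0 + I \<phi> t" if "t \<ge> 0" for t
    using that unfolding zf_def fixed P_def by (simp add: exp_minus)
  show thesis
  proof
    show "zf \<phi> 0 = z0" using zI[of 0] by (simp add: I_def)
    fix t :: real assume t: "t \<ge> 0"
    have "((\<lambda>t. z0 + I \<phi> t) has_vector_derivative 0 + G (zf \<phi> t)) (at t within {0..})"
      by (intro has_vector_derivative_add has_vector_derivative_const Ider t)
    then have "((\<lambda>t. z0 + I \<phi> t) has_vector_derivative G (zf \<phi> t)) (at t within {0..})" by simp
    then show "(zf \<phi> has_vector_derivative G (zf \<phi> t)) (at t within {0..})"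
      using t zI by (intro has_vector_derivative_transform[of t "{0..}" "zf \<phi>" "\<lambda>t. z0 + I \<phi> t"]) auto
  qed
qed

text \<open>Nearest-point projection onto a ball is 1-Lipschitz, so precomposing with it turns a
  field that is Lipschitz on the ball into one that is globally Lipschitz and bounded. As long as
  the solution stays in the ball, it solves the original equation.\<close>

lemma retracted_solution_exists:
  fixes G :: "'a::euclidean_space \<Rightarrow> 'a"
  assumes lip: "L-lipschitz_on (cball a r) G" and r: "r > 0"
  obtains z where "z 0 = z0"
    "\<And>t. t \<ge> 0 \<Longrightarrow> (z has_vector_derivative G (closest_point (cball a r) (z t))) (at t within {0..})"
proof -
  let ?c = "closest_point (cball a r)"
  have ne: "cball a r \<noteq> {}" using r by auto
  have c: "?c x \<in> cball a r" for x by (rule closest_point_in_set) (use ne in auto)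
  have clip: "1-lipschitz_on UNIV ?c"
    by (rule lipschitz_onI) (use closest_point_lipschitz[of "cball a r"] ne in auto)
  have "(L * 1)-lipschitz_on UNIV (\<lambda>x. G (?c x))"
    by (rule lipschitz_on_compose2[OF clip]) (use lip lipschitz_on_subset c in blast)
  moreover have "bounded (range (\<lambda>x. G (?c x)))"
  proof -
    have "compact (G ` cball a r)"
      using lip by (intro compact_continuous_image lipschitz_on_continuous_on) auto
    then show ?thesis using c by (intro bounded_subset[OF compact_imp_bounded]) auto
  qed
  ultimately show thesis using global_solution_exists[of "L*1" "\<lambda>x. G (?c x)" z0] that by metis
qed


section \<open>Lyapunov functions: decay, trapping and stability\<close>

text \<open>The function \<open>exp (\<mu> * t) * U (z t)\<close> has nonpositive derivative. The
  case \<open>\<mu> = 0\<close> gives plain monotonicity of \<open>U\<close> along the path.\<close>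

lemma lyapunov_decay:
  fixes z :: "real \<Rightarrow> 's::euclidean_space"
  assumes t1: "t1 \<ge> 0"
    and zder: "\<And>t. t \<in> {0..t1} \<Longrightarrow> (z has_vector_derivative G (z t)) (at t within {0..t1})"
    and dU: "\<And>t. t \<in> {0..t1} \<Longrightarrow> (U has_derivative U' (z t)) (at (z t))"
    and dec: "\<And>t. t \<in> {0..t1} \<Longrightarrow> U' (z t) (G (z t)) \<le> - \<mu> * U (z t)"
  shows "U (z t1) \<le> exp (- \<mu> * t1) * U (z 0)"
proof -
  define h where "h t = exp (\<mu> * t) * U (z t)" for t
  have Uz: "((\<lambda>t. U (z t)) has_real_derivative U' (z t) (G (z t))) (at t within {0..t1})"
    if "t \<in> {0..t1}" for t
    unfolding has_real_derivative_iff_has_vector_derivative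
    using vector_derivative_diff_chain_within[OF zder[OF that] has_derivative_at_withinI[OF dU[OF that]]]
    by (simp add: o_def)
  have h': "(h has_real_derivative exp (\<mu> * t) * (\<mu> * U (z t) + U' (z t) (G (z t)))) (at t within {0..t1})"
    if "t \<in> {0..t1}" for t
    unfolding h_def using that
    by (auto intro!: derivative_eq_intros Uz simp: algebra_simps)
  have "h t1 \<le> h 0"
  proof (rule DERIV_nonpos_imp_decreasing_open[OF t1])
    show "continuous_on {0..t1} h" using h' by (rule DERIV_continuous_on)
    fix t assume t: "0 < t" "t < t1"
    then have "at t within {0..t1} = at t" by (intro at_within_Icc_at) auto
    moreover have "exp (\<mu> * t) * (\<mu> * U (z t) + U' (z t) (G (z t))) \<le> 0"
      using dec[of t] t by (intro mult_nonneg_nonpos) auto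
    ultimately show "\<exists>y. DERIV h t :> y \<and> y \<le> 0" using h'[of t] t by auto
  qed
  then show ?thesis by (simp add: h_def exp_minus field_simps)
qed

text \<open>First-exit argument: on reaching the sphere of radius \<epsilon>, \<open>U\<close> would
  be at least \<open>c * \<epsilon>\<^sup>2\<close>, yet it starts below that value and cannot
  increase before. The equation is demanded only inside the ball, so solutions of a retracted field
  are covered.\<close>

lemma lyapunov_trapping:
  fixes z :: "real \<Rightarrow> 's::euclidean_space"
  assumes t1: "t1 \<ge> 0" and zc: "continuous_on {0..t1} z"
    and zder: "\<And>t. \<lbrakk>t \<in> {0..t1}; z t \<in> cball a \<epsilon>\<rbrakk> \<Longrightarrow> (z has_vector_derivative G (z t)) (at t within {0..t1})"
    and dU: "\<And>y. y \<in> cball a \<epsilon> \<Longrightarrow> (U has_derivative U' y) (at y)"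
    and dec: "\<And>y. y \<in> cball a \<epsilon> \<Longrightarrow> U' y (G y) \<le> 0"
    and low: "\<And>y. y \<in> cball a \<epsilon> \<Longrightarrow> c * (dist y a)\<^sup>2 \<le> U y"
    and init: "dist (z 0) a < \<epsilon>" "U (z 0) < c * \<epsilon>\<^sup>2"
  shows "dist (z t1) a < \<epsilon>"
proof (rule ccontr)
  assume "\<not> dist (z t1) a < \<epsilon>"
  define S where "S = {t \<in> {0..t1}. \<epsilon> \<le> dist (z t) a}"
  have cd: "continuous_on {0..t1} (\<lambda>t. dist (z t) a)" by (intro continuous_intros zc)
  have "closed S" unfolding S_def
    by (intro continuous_on_closed_Collect_le cd continuous_intros)
  moreover have "bounded S" unfolding S_def by (rule bounded_subset[of "{0..t1}"]) auto
  ultimately have "compact S" by (simp add: compact_eq_bounded_closed)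
  moreover have "t1 \<in> S" using \<open>\<not> dist (z t1) a < \<epsilon>\<close> t1 by (simp add: S_def)
  ultimately obtain s where s: "s \<in> S" "\<And>t. t \<in> S \<Longrightarrow> s \<le> t"
    using compact_attains_inf[of S] by blast
  have s0: "0 \<le> s" "s \<le> t1" "\<epsilon> \<le> dist (z s) a" using s(1) by (auto simp: S_def)
  \<comment> \<open>By continuity the distance equals \<epsilon> at some time up to
    \<open>s\<close>; minimality of \<open>s\<close> makes that time \<open>s\<close> itself, so the
    path up to \<open>s\<close> lies in the closed ball.\<close>
  obtain s' where s': "0 \<le> s'" "s' \<le> s" "dist (z s') a = \<epsilon>"
    using IVT'[of "\<lambda>t. dist (z t) a" 0 \<epsilon> s] init s0 continuous_on_subset[OF cd, of "{0..s}"] by auto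
  have eq: "dist (z s) a = \<epsilon>"
  proof -
    have "s' \<in> S" using s' s0 by (auto simp: S_def)
    then show ?thesis using s(2) s' by force
  qed
  have inside: "z t \<in> cball a \<epsilon>" if "t \<in> {0..s}" for t
  proof (cases "t = s")
    case False
    then have "t \<notin> S" using s(2)[of t] that by force
    then show ?thesis using that s0 by (auto simp: S_def dist_commute)
  qed (use eq in \<open>auto simp: dist_commute\<close>)
  have "U (z s) \<le> exp (- 0 * s) * U (z 0)"
  proof (rule lyapunov_decay[where G = G and U' = U', OF s0(1)])
    fix t assume t: "t \<in> {0..s}"
    show "(z has_vector_derivative G (z t)) (at t within {0..s})"
      using zder[OF _ inside[OF t]] t s0
      by (intro has_vector_derivative_within_subset[of _ _ t "{0..t1}" "{0..s}"]) auto
    show "(U has_derivative U' (z t)) (at (z t))" by (rule dU[OF inside[OF t]])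
    show "U' (z t) (G (z t)) \<le> - 0 * U (z t)" using dec[OF inside[OF t]] by simp
  qed
  with low[of "z s"] inside[of s] s0 eq init(2) show False by simp
qed

text \<open>Trapping gives stability and also keeps the retracted solution in the ball, so that it
  is a genuine global trajectory. Exponential decay of \<open>U\<close> and its quadratic lower
  bound then give convergence.\<close>

lemma exponential_lyapunov:
  fixes F :: "'s::euclidean_space \<Rightarrow> 'w::zero \<Rightarrow> 's"
  assumes r: "r > 0" and lip: "L-lipschitz_on (cball a r) (\<lambda>z. F z 0)"
    and eq: "F a 0 = 0"
    and dU: "\<And>z. z \<in> cball a r \<Longrightarrow> (U has_derivative U' z) (at z)"
    and Ua: "U a = 0"
    and c: "c > 0" and low: "\<And>z. z \<in> cball a r \<Longrightarrow> c * (dist z a)\<^sup>2 \<le> U z"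
    and \<mu>: "\<mu> > 0" and dec: "\<And>z. z \<in> cball a r \<Longrightarrow> U' z (F z 0) \<le> - \<mu> * U z"
  shows "asymptotically_stable_equilibrium F a"
proof -
  have U0: "0 \<le> U z" if "z \<in> cball a r" for z
    using low[OF that] c by (meson mult_nonneg_nonneg less_imp_le order_trans zero_le_power2)
  have dec0: "U' z (F z 0) \<le> 0" if "z \<in> cball a r" for z
    using dec[OF that] mult_nonneg_nonneg[OF less_imp_le[OF \<mu>] U0[OF that]] by linarith
  have small: "\<exists>\<delta>>0. \<forall>z. dist z a < \<delta> \<longrightarrow> dist z a < \<epsilon> \<and> U z < c * \<epsilon>\<^sup>2" if "\<epsilon> > 0" for \<epsilon>
  proof -
    have "isCont U a" by (rule has_derivative_continuous[OF dU]) (use r in auto)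
    moreover have "c * \<epsilon>\<^sup>2 > 0" using c that by simp
    ultimately obtain d where "d > 0" "\<And>z. dist z a < d \<Longrightarrow> dist (U z) (U a) < c * \<epsilon>\<^sup>2"
      unfolding continuous_within_eps_delta by blast
    then have "dist z a < \<epsilon> \<and> U z < c * \<epsilon>\<^sup>2" if "dist z a < min d \<epsilon>" for z
      using that by (fastforce simp: Ua dist_real_def)
    with \<open>d > 0\<close> \<open>\<epsilon> > 0\<close> show ?thesis by (intro exI[of _ "min d \<epsilon>"]) auto
  qed
  \<comment> \<open>\<open>I\<close> is left general to serve both \<open>{0..<T}\<close> and
    \<open>{0..}\<close>; the derivative is asked for only in the ball, to serve retracted
    solutions.\<close>
  have trap: "dist (z t) a < \<epsilon>"
    if \<epsilon>: "\<epsilon> > 0" "\<epsilon> \<le> r" and init: "dist (z 0) a < \<epsilon> \<and> U (z 0) < c * \<epsilon>\<^sup>2"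
      and t: "t \<ge> 0" "{0..t} \<subseteq> I" and zc: "continuous_on I z"
      and der: "\<And>t. \<lbrakk>t \<in> I; z t \<in> cball a r\<rbrakk> \<Longrightarrow> (z has_vector_derivative F (z t) 0) (at t within I)"
    for \<epsilon> z t I
  proof (rule lyapunov_trapping[where G = "\<lambda>z. F z 0" and U = U and U' = U' and c = c, OF t(1)])
    have sub: "cball a \<epsilon> \<subseteq> cball a r" using \<epsilon> by auto
    show "continuous_on {0..t} z" using zc t(2) continuous_on_subset by blast
    show "(z has_vector_derivative F (z s) 0) (at s within {0..t})"
      if "s \<in> {0..t}" "z s \<in> cball a \<epsilon>" for s
      by (rule has_vector_derivative_within_subset[OF der t(2)]) (use that sub t(2) in blast)+
    show "(U has_derivative U' y) (at y)" "U' y (F y 0) \<le> 0" "c * (dist y a)\<^sup>2 \<le> U y"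
      if "y \<in> cball a \<epsilon>" for y
      using that sub by (blast intro: dU dec0 low)+
    show "dist (z 0) a < \<epsilon>" "U (z 0) < c * \<epsilon>\<^sup>2" using init by auto
  qed
  have trajc: "continuous_on I z" if "trajectory F I (\<lambda>_. 0) z" for I z
    using that unfolding trajectory_def
    by (intro continuous_on_vector_derivative[of I z "\<lambda>t. F (z t) 0"]) blast
  have trajd: "(z has_vector_derivative F (z t) 0) (at t within I)"
    if "trajectory F I (\<lambda>_. 0) z" "t \<in> I" for I z t
    using that unfolding trajectory_def by blast
  have ex: "\<exists>z. trajectory F {0..} (\<lambda>_. 0) z \<and> z 0 = z0"
    if z0: "dist z0 a < r" "U z0 < c * r\<^sup>2" for z0
  proof -
    obtain z where z: "z 0 = z0"
      "\<And>t. t \<ge> 0 \<Longrightarrow> (z has_vector_derivative F (closest_point (cball a r) (z t)) 0) (at t within {0..})"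
      using retracted_solution_exists[OF lip r, of z0] by blast
    have zc: "continuous_on {0..} z"
      by (rule continuous_on_vector_derivative) (use z in auto)
    have zF: "(z has_vector_derivative F (z t) 0) (at t within {0..})"
      if "t \<in> {0..}" "z t \<in> cball a r" for t
      using z(2)[of t] that by (simp add: closest_point_self)
    have "dist (z t) a < r" if "t \<ge> 0" for t
      by (rule trap[OF r order_refl _ that _ zc zF]) (use z0 z(1) in auto)
    then have "trajectory F {0..} (\<lambda>_. 0) z"
      unfolding trajectory_def using zF by (auto simp: dist_commute less_imp_le)
    with z(1) show ?thesis by blast
  qed
  have stable: "stable_equilibrium F a"
    unfolding stable_equilibrium_def
  proof (intro conjI allI impI)
    show "F a 0 = 0" by (rule eq)
    fix \<epsilon> :: real assume \<epsilon>: "\<epsilon> > 0"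
    \<comment> \<open>Capped at \<open>r\<close>, since the estimates on \<open>U\<close> are
      available only in that ball.\<close>
    define e where "e = min \<epsilon> r"
    have e: "e > 0" "e \<le> r" "e \<le> \<epsilon>" using \<epsilon> r by (auto simp: e_def)
    obtain \<delta>1 where d1: "\<delta>1 > 0" "\<And>z. dist z a < \<delta>1 \<Longrightarrow> dist z a < e \<and> U z < c * e\<^sup>2"
      using small[OF e(1)] by blast
    have er: "c * e\<^sup>2 \<le> c * r\<^sup>2" using c e by (intro mult_left_mono power_mono) auto
    show "\<exists>\<delta>>0. \<forall>z0. dist z0 a < \<delta> \<longrightarrow>
        (\<exists>z. trajectory F {0..} (\<lambda>_. 0) z \<and> z 0 = z0) \<and>
        (\<forall>T>0. \<forall>z. trajectory F {0..<T} (\<lambda>_. 0) z \<and> z 0 = z0 \<longrightarrow>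
           (\<forall>t\<in>{0..<T}. dist (z t) a < \<epsilon>))"
    proof (intro exI[of _ \<delta>1] conjI allI impI ballI d1(1))
      fix z0 assume z0: "dist z0 a < \<delta>1"
      show "\<exists>z. trajectory F {0..} (\<lambda>_. 0) z \<and> z 0 = z0"
        by (rule ex) (use d1(2)[OF z0] e er in auto)
      fix T :: real and z t
      assume T: "T > 0" and z: "trajectory F {0..<T} (\<lambda>_. 0) z \<and> z 0 = z0" and t: "t \<in> {0..<T}"
      have "dist (z t) a < e"
        by (rule trap[OF e(1,2) _ _ _ trajc[OF conjunct1[OF z]] trajd[OF conjunct1[OF z]]])
          (use d1(2)[OF z0] z t in auto)
      with e show "dist (z t) a < \<epsilon>" by simp
    qed
  qed
  obtain \<delta> where \<delta>: "\<delta> > 0" "\<And>z. dist z a < \<delta> \<Longrightarrow> dist z a < r \<and> U z < c * r\<^sup>2"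
    using small[OF r] by blast
  have "(z \<longlongrightarrow> a) at_top" if z: "trajectory F {0..} (\<lambda>_. 0) z" "dist (z 0) a < \<delta>" for z
  proof -
    have inside: "z t \<in> cball a r" if "t \<ge> 0" for t
    proof -
      have "dist (z t) a < r"
        by (rule trap[OF r order_refl \<delta>(2)[OF z(2)] that _ trajc[OF z(1)] trajd[OF z(1)]]) auto
      then show ?thesis by (simp add: dist_commute)
    qed
    have bound: "(dist (z t) a)\<^sup>2 \<le> U (z 0) / c * exp (- \<mu> * t)" if t: "t \<ge> 0" for t
    proof -
      have "U (z t) \<le> exp (- \<mu> * t) * U (z 0)"
      proof (rule lyapunov_decay[OF t, where G = "\<lambda>z. F z 0" and U' = U'])
        fix s assume s: "s \<in> {0..t}"
        show "(z has_vector_derivative F (z s) 0) (at s within {0..t})"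
          using s by (intro has_vector_derivative_within_subset[OF trajd[OF z(1)]]) auto
        show "(U has_derivative U' (z s)) (at (z s))" "U' (z s) (F (z s) 0) \<le> - \<mu> * U (z s)"
          using dU[OF inside[of s]] dec[OF inside[of s]] s by simp_all
      qed
      with low[OF inside[OF t]] have "c * (dist (z t) a)\<^sup>2 \<le> exp (- \<mu> * t) * U (z 0)" by linarith
      with c show ?thesis by (simp add: field_simps)
    qed
    have "((\<lambda>t. U (z 0) / c * exp (- \<mu> * t)) \<longlongrightarrow> U (z 0) / c * 0) at_top"
    proof (intro tendsto_mult tendsto_const filterlim_compose[OF exp_at_bot])
      show "LIM t at_top. - \<mu> * t :> at_bot"
        using filterlim_tendsto_neg_mult_at_bot[OF tendsto_const[of "- \<mu>"] _ filterlim_ident] \<mu> by simp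
    qed
    then have lim: "((\<lambda>t. U (z 0) / c * exp (- \<mu> * t)) \<longlongrightarrow> 0) at_top" by (simp only: mult_zero_right)
    have "((\<lambda>t. (dist (z t) a)\<^sup>2) \<longlongrightarrow> 0) at_top"
    proof (rule tendsto_sandwich[OF _ _ tendsto_const lim])
      show "\<forall>\<^sub>F t in at_top. 0 \<le> (dist (z t) a)\<^sup>2" by simp
      show "\<forall>\<^sub>F t in at_top. (dist (z t) a)\<^sup>2 \<le> U (z 0) / c * exp (- \<mu> * t)"
        by (rule eventually_mono[OF eventually_ge_at_top[of 0] bound])
    qed
    then have "((\<lambda>t. sqrt ((dist (z t) a)\<^sup>2)) \<longlongrightarrow> sqrt 0) at_top" by (rule tendsto_real_sqrt)
    then show ?thesis by (simp add: tendsto_dist_iff[of z])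
  qed
  with stable \<delta>(1) show ?thesis unfolding asymptotically_stable_equilibrium_def by blast
qed

section \<open>Linear algebra and local estimates\<close>

lemma smooth_has_derivative:
  "smooth h \<Longrightarrow> (h has_derivative frechet_derivative h (at x)) (at x)"
  unfolding smooth_def using frechet_derivative_works Ck.simps(2) by blast

lemma smooth_frechet_derivative:
  "smooth h \<Longrightarrow> smooth (\<lambda>x. frechet_derivative h (at x) v)"
  unfolding smooth_def using Ck.simps(2) by blast

lemma smooth_continuous: "smooth h \<Longrightarrow> continuous_on S h"
  unfolding smooth_def using Ck.simps(1) continuous_on_subset by blast

lemma bounded_bilinear_matrix_vector_mult:
  "bounded_bilinear (\<lambda>(A::real^'m^'n) v. A *v v)"
  unfolding bilinear_conv_bounded_bilinear[symmetric] bilinear_def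
  by (auto intro!: linearI simp: algebra_simps scaleR_matrix_vector_assoc)

lemma bounded_bilinear_transpose_vector_mult:
  "bounded_bilinear (\<lambda>(A::real^'m^'n) v. transpose A *v v)"
  unfolding bilinear_conv_bounded_bilinear[symmetric] bilinear_def
  by (auto intro!: linearI simp: algebra_simps vector_matrix_mult_def vec_eq_iff sum.distrib sum_distrib_left)

lemmas continuous_on_matrix_vector_mult =
  bounded_bilinear.continuous_on[OF bounded_bilinear_matrix_vector_mult]
lemmas continuous_on_transpose_vector_mult =
  bounded_bilinear.continuous_on[OF bounded_bilinear_transpose_vector_mult]

lemma inner_transpose_mult: "x \<bullet> (transpose A *v y) = (A *v x) \<bullet> (y::real^'n)" for A :: "real^'m^'n"
  by (metis dot_lmul_matrix inner_commute transpose_matrix_vector)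

text \<open>The range of \<open>A\<close> lies in the kernel of \<open>B\<close> and both have
  dimension \<open>CARD('m)\<close>, so they coincide.\<close>

lemma left_annihilator_kernel:
  fixes A :: "real^'m^'n" and B :: "real^'n^'k"
  assumes "rank A = CARD('m)" "rank B = CARD('n) - CARD('m)" "CARD('m) \<le> CARD('n)"
    and "B ** A = 0"
    and "B *v v = 0"
  obtains c where "v = A *v c"
proof -
  \<comment> \<open>The kernel is the orthogonal complement of the row space, which yields its
    dimension from the rank of \<open>B\<close>.\<close>
  have ker: "{y. B *v y = 0} = {y \<in> UNIV. \<forall>x \<in> span (rows B). orthogonal x y}" (is "?K = _")
  proof -
    have "B *v y = 0 \<longleftrightarrow> (\<forall>x \<in> rows B. orthogonal x y)" for y
    proof -
      have "B *v y = 0 \<longleftrightarrow> (\<forall>i. B $ i \<bullet> y = 0)" by (simp add: vec_eq_iff matrix_vector_mul_component)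
      also have "\<dots> \<longleftrightarrow> (\<forall>x \<in> range (\<lambda>i. B $ i). orthogonal x y)" unfolding orthogonal_def by simp
      also have "range (\<lambda>i. B $ i) = rows B" by (auto simp: rows_def row_def)
      finally show ?thesis .
    qed
    moreover have "(\<forall>x \<in> rows B. orthogonal x y) \<longleftrightarrow> (\<forall>x \<in> span (rows B). orthogonal x y)" for y
      using orthogonal_to_span[of _ "rows B" y] span_base[of _ "rows B"] by (auto simp: orthogonal_commute)
    ultimately show ?thesis by auto
  qed
  have "dim ?K + dim (span (rows B)) = CARD('n)"
    unfolding ker using dim_subspace_orthogonal_to_vectors[OF subspace_span subspace_UNIV subset_UNIV, of "rows B"]
    by simp
  then have "dim ?K = CARD('m)" using assms(2,3) by (simp add: row_rank_def)
  moreover have "dim (range ((*v) A)) = CARD('m)" using assms(1) by (simp add: rank_dim_range)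
  moreover have "subspace (range ((*v) A))"
    by (rule linear_subspace_image) (auto intro: subspace_UNIV)
  moreover have "subspace ?K" by (rule linear_subspace_kernel) auto
  moreover have "range ((*v) A) \<subseteq> ?K" using assms(4) by (auto simp: matrix_vector_mul_assoc)
  ultimately have "range ((*v) A) = ?K" by (intro subspace_dim_equal) auto
  with assms(5) show thesis using that by blast
qed

text \<open>The matrix applied to \<open>A *v c\<close> is the orthogonal projection onto the range
  of \<open>A\<close>. The Gram matrix is invertible because pairing its value at \<open>c\<close>
  with \<open>c\<close> gives the squared norm of \<open>A *v c\<close>.\<close>

lemma normal_equations_projection:
  fixes A :: "real^'m^'n"
  assumes "rank A = CARD('m)"
  shows "A *v (matrix_inv (transpose A ** A) *v (transpose A *v (A *v c))) = A *v c"
proof -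
  let ?N = "transpose A ** A"
  have "inj ((*v) A)" using assms full_rank_injective by blast
  have "c = 0" if "?N *v c = 0" for c
  proof -
    have "(A *v c) \<bullet> (A *v c) = 0"
      using that inner_transpose_mult[of c A "A *v c"] by (simp add: matrix_vector_mul_assoc)
    then show ?thesis using \<open>inj ((*v) A)\<close> by (metis inner_eq_zero_iff injD matrix_vector_mult_0_right)
  qed
  then have "invertible ?N" using matrix_left_invertible_ker invertible_left_inverse by blast
  then have "matrix_inv ?N ** ?N = mat 1"
    unfolding matrix_inv_def invertible_def by (rule someI2_ex) blast
  then show ?thesis by (simp add: matrix_vector_mul_assoc)
qed

section \<open>Lipschitz continuity on compact sets\<close>

lemma lipschitz_on_bilinear:
  assumes B: "bounded_bilinear B" and S: "compact S"
    and f: "\<exists>L. L-lipschitz_on S f" and g: "\<exists>L. L-lipschitz_on S g"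
  shows "\<exists>L. L-lipschitz_on S (\<lambda>x. B (f x) (g x))"
proof -
  interpret bounded_bilinear B by fact
  obtain Lf Lg where Lf: "Lf-lipschitz_on S f" and Lg: "Lg-lipschitz_on S g" using f g by blast
  obtain bf where bf: "bf > 0" "\<And>x. x \<in> S \<Longrightarrow> norm (f x) \<le> bf"
    using compact_imp_bounded[OF compact_continuous_image[OF lipschitz_on_continuous_on[OF Lf] S]]
    unfolding bounded_pos by auto
  obtain bg where bg: "bg > 0" "\<And>x. x \<in> S \<Longrightarrow> norm (g x) \<le> bg"
    using compact_imp_bounded[OF compact_continuous_image[OF lipschitz_on_continuous_on[OF Lg] S]]
    unfolding bounded_pos by auto
  obtain K where K: "K > 0" "\<And>a b. norm (B a b) \<le> norm a * norm b * K" using pos_bounded by blast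
  have "(bf * Lg * K + Lf * bg * K)-lipschitz_on S (\<lambda>x. B (f x) (g x))"
  proof (rule lipschitz_onI)
    show "0 \<le> bf * Lg * K + Lf * bg * K"
      using bf bg K lipschitz_on_nonneg[OF Lf] lipschitz_on_nonneg[OF Lg] by simp
    fix x y assume xy: "x \<in> S" "y \<in> S"
    have "B (f x) (g x) - B (f y) (g y) = B (f x) (g x - g y) + B (f x - f y) (g y)"
      by (simp add: diff_left diff_right)
    then have "dist (B (f x) (g x)) (B (f y) (g y)) \<le> norm (B (f x) (g x - g y)) + norm (B (f x - f y) (g y))"
      by (simp add: dist_norm norm_triangle_ineq)
    also have "\<dots> \<le> bf * (Lg * dist x y) * K + Lf * dist x y * bg * K"
    proof (intro add_mono order_trans[OF K(2)] mult_right_mono mult_mono)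
      show "norm (g x - g y) \<le> Lg * dist x y" "norm (f x - f y) \<le> Lf * dist x y"
        using lipschitz_onD[OF Lg xy] lipschitz_onD[OF Lf xy] by (simp_all add: dist_norm)
    qed (use xy bf bg K lipschitz_on_nonneg[OF Lf] lipschitz_on_nonneg[OF Lg] in auto)
    finally show "dist (B (f x) (g x)) (B (f y) (g y)) \<le> (bf * Lg * K + Lf * bg * K) * dist x y"
      by (simp add: algebra_simps)
  qed
  then show ?thesis ..
qed

text \<open>Mean value inequality. Continuity is required only in each fixed direction, the form
  that \<open>smooth\<close> supplies; the finitely many basis directions bound the operator
  norm.\<close>

lemma lipschitz_on_C1:
  fixes h :: "'a::euclidean_space \<Rightarrow> 'b::real_normed_vector"
  assumes S: "compact S" "convex S"
    and der: "\<And>x. x \<in> S \<Longrightarrow> (h has_derivative h' x) (at x)"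
    and cont: "\<And>v. continuous_on S (\<lambda>x. h' x v)"
  shows "\<exists>L. L-lipschitz_on S h"
proof -
  have "\<exists>B. \<forall>x\<in>S. norm (h' x b) \<le> B" for b
    using compact_imp_bounded[OF compact_continuous_image[OF cont S(1)], of b]
    unfolding bounded_iff by auto
  then obtain B where B: "\<And>b x. x \<in> S \<Longrightarrow> norm (h' x b) \<le> B b" by metis
  let ?L = "\<bar>\<Sum>b\<in>Basis. B b\<bar>"
  have "?L-lipschitz_on S h"
  proof (rule lipschitz_onI)
    fix x y assume xy: "x \<in> S" "y \<in> S"
    have "norm (h x - h y) \<le> ?L * norm (x - y)"
    proof (rule differentiable_bound[OF S(2) _ _ xy])
      fix x assume x: "x \<in> S"
      show "(h has_derivative h' x) (at x within S)" using der[OF x] by (rule has_derivative_at_withinI)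
      interpret bounded_linear "h' x" using der[OF x] by (rule has_derivative_bounded_linear)
      show "onorm (h' x) \<le> ?L"
      proof (rule onorm_bound)
        fix v :: 'a
        have "h' x v = (\<Sum>b\<in>Basis. (v \<bullet> b) *\<^sub>R h' x b)"
          by (subst euclidean_representation[of v, symmetric]) (simp add: sum scaleR)
        also have "norm \<dots> \<le> (\<Sum>b\<in>Basis. norm v * B b)"
          by (rule sum_norm_le) (auto intro!: mult_mono Basis_le_norm B x)
        also have "\<dots> \<le> ?L * norm v"
          using mult_right_mono[OF abs_ge_self, of "norm v" "\<Sum>b\<in>Basis. B b"]
          by (simp add: sum_distrib_right[symmetric] mult.commute)
        finally show "norm (h' x v) \<le> ?L * norm v" .
      qed simp
    qed
    then show "dist (h x) (h y) \<le> ?L * dist x y" by (simp add: dist_norm)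
  qed simp
  then show ?thesis ..
qed

text \<open>Allows treating \<open>\<alpha> u\<close> as the solution of a linear system, without regularity of \<open>matrix_inv\<close>.\<close>

lemma lipschitz_on_linear_solve:
  fixes A :: "'a::euclidean_space \<Rightarrow> real^'m^'n"
  assumes S: "compact S"
    and A: "\<exists>L. L-lipschitz_on S A" and b: "\<exists>L. L-lipschitz_on S b"
    and inj: "\<And>x. x \<in> S \<Longrightarrow> inj ((*v) (A x))"
    and sol: "\<And>x. x \<in> S \<Longrightarrow> A x *v c x = b x"
  shows "\<exists>L. L-lipschitz_on S c"
proof (cases "S = {}")
  case True
  then show ?thesis by (intro exI[of _ 0]) simp
next
  case ne: False
  obtain La Lb where La: "La-lipschitz_on S A" and Lb: "Lb-lipschitz_on S b" using A b by blast
  note Ac = lipschitz_on_continuous_on[OF La] and bc = lipschitz_on_continuous_on[OF Lb]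
  \<comment> \<open>By injectivity the minimum of \<open>norm (A x *v v)\<close> over this compact
    set is positive, which gives one lower bound \<open>k\<close> valid for all
    \<open>x\<close>.\<close>
  let ?T = "S \<times> sphere (0::real^'m) 1"
  have ne': "?T \<noteq> {}" using ne by (auto simp: sphere_def intro!: exI[of _ "axis undefined 1"])
  have "compact ?T" using S by (intro compact_Times) auto
  moreover have "continuous_on ?T (\<lambda>z. norm (A (fst z) *v snd z))"
    by (intro continuous_on_norm continuous_on_matrix_vector_mult continuous_on_compose2[OF Ac] continuous_intros) auto
  ultimately obtain z0 where z0: "z0 \<in> ?T" "\<And>z. z \<in> ?T \<Longrightarrow> norm (A (fst z0) *v snd z0) \<le> norm (A (fst z) *v snd z)"
    using continuous_attains_inf[OF _ ne'] by blast
  define k where "k = norm (A (fst z0) *v snd z0)"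
  have "A (fst z0) *v snd z0 \<noteq> 0"
  proof
    assume "A (fst z0) *v snd z0 = 0"
    then have "snd z0 = 0" using inj[of "fst z0"] z0(1) by (metis injD matrix_vector_mult_0_right mem_Times_iff)
    then show False using z0(1) by auto
  qed
  then have k: "k > 0" by (simp add: k_def)
  have low: "k * norm v \<le> norm (A x *v v)" if x: "x \<in> S" for x v
  proof (cases "v = 0")
    case False
    have "k \<le> norm (A x *v ((1 / norm v) *\<^sub>R v))"
      using z0(2)[of "(x, (1 / norm v) *\<^sub>R v)"] x False by (simp add: k_def)
    also have "\<dots> = norm (A x *v v) / norm v" by (simp add: matrix_vector_mult_scaleR)
    finally show ?thesis using False by (simp add: field_simps)
  qed simp
  obtain bb where bb: "bb > 0" "\<And>x. x \<in> S \<Longrightarrow> norm (b x) \<le> bb"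
    using compact_imp_bounded[OF compact_continuous_image[OF bc S]] unfolding bounded_pos by auto
  have cb: "norm (c x) \<le> bb / k" if "x \<in> S" for x
  proof -
    have "k * norm (c x) \<le> norm (b x)" using low[OF that, of "c x"] sol[OF that] by simp
    also have "\<dots> \<le> bb" by (rule bb(2)[OF that])
    finally show ?thesis using k by (simp add: field_simps)
  qed
  obtain K where K: "K > 0" "\<And>(A::real^'m^'n) v. norm (A *v v) \<le> norm A * norm v * K"
    using bounded_bilinear.pos_bounded[OF bounded_bilinear_matrix_vector_mult] by blast
  have "((Lb + La * (bb / k) * K) / k)-lipschitz_on S c"
  proof (rule lipschitz_onI)
    show "0 \<le> (Lb + La * (bb / k) * K) / k"
      using bb k K lipschitz_on_nonneg[OF La] lipschitz_on_nonneg[OF Lb] by simp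
    fix x y assume xy: "x \<in> S" "y \<in> S"
    have "k * norm (c x - c y) \<le> norm (A x *v (c x - c y))" by (rule low[OF xy(1)])
    \<comment> \<open>Perturbation of a linear system: the change of the solution is driven by the
      changes of the right-hand side and of the matrix.\<close>
    also have "A x *v (c x - c y) = (b x - b y) - (A x - A y) *v c y"
      using sol[OF xy(1)] sol[OF xy(2)] by (simp add: algebra_simps)
    also have "norm \<dots> \<le> norm (b x - b y) + norm ((A x - A y) *v c y)" by (rule norm_triangle_ineq4)
    also have "\<dots> \<le> Lb * dist x y + La * dist x y * (bb / k) * K"
    proof (intro add_mono order_trans[OF K(2)] mult_right_mono mult_mono)
      show "norm (b x - b y) \<le> Lb * dist x y" "norm (A x - A y) \<le> La * dist x y"
        using lipschitz_onD[OF La xy] lipschitz_onD[OF Lb xy] by (simp_all add: dist_norm)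
    qed (use cb[OF xy(2)] bb k K lipschitz_on_nonneg[OF La] in auto)
    finally show "dist (c x) (c y) \<le> (Lb + La * (bb / k) * K) / k * dist x y"
      using k by (simp add: dist_norm field_simps)
  qed
  then show ?thesis ..
qed

section \<open>Compactness estimates near a point\<close>

text \<open>Finsler's lemma: on the compact set where \<open>R \<ge> 0\<close> the function \<open>N\<close> is bounded away from 0.\<close>

lemma finsler_compact:
  fixes N R :: "'a::metric_space \<Rightarrow> real"
  assumes S: "compact S" and N: "continuous_on S N" and R: "continuous_on S R"
    and N0: "\<And>z. z \<in> S \<Longrightarrow> 0 \<le> N z" and RN: "\<And>z. \<lbrakk>z \<in> S; N z = 0\<rbrakk> \<Longrightarrow> R z < 0"
  shows "\<exists>\<epsilon>0>0. \<forall>\<epsilon>. 0 < \<epsilon> \<and> \<epsilon> \<le> \<epsilon>0 \<longrightarrow> (\<forall>z\<in>S. \<epsilon> * R z < N z)"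
proof -
  define K where "K = {z \<in> S. 0 \<le> R z}"
  have Rneg: "\<epsilon> * R z < N z" if "z \<in> S" "z \<notin> K" "\<epsilon> > 0" for z \<epsilon>
    using N0[OF that(1)] that mult_pos_neg[of \<epsilon> "R z"] by (force simp: K_def)
  show ?thesis
  proof (cases "K = {}")
    case True
    then show ?thesis using Rneg by (intro exI[of _ 1]) auto
  next
    case False
    have sub: "K \<subseteq> S" by (auto simp: K_def)
    have "closed K" unfolding K_def
      using S R by (intro continuous_on_closed_Collect_le continuous_on_const compact_imp_closed)
    with S sub have K: "compact K" using compact_Int_closed[of S K] by (simp add: Int_absorb1)
    obtain a where a: "a \<in> K" "\<And>z. z \<in> K \<Longrightarrow> N a \<le> N z"
      using continuous_attains_inf[OF K False continuous_on_subset[OF N sub]] by blast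
    obtain b where b: "b \<in> K" "\<And>z. z \<in> K \<Longrightarrow> R z \<le> R b"
      using continuous_attains_sup[OF K False continuous_on_subset[OF R sub]] by blast
    have Na: "N a > 0" using a(1) N0[of a] RN[of a] by (force simp: K_def)
    have Rb: "R b \<ge> 0" using b(1) by (simp add: K_def)
    \<comment> \<open>The threshold is the minimum of \<open>N\<close> on \<open>K\<close> over the
      maximum of \<open>R\<close> there; the added 1 keeps the denominator positive and the
      inequality strict.\<close>
    have "\<epsilon> * R z < N z" if \<epsilon>: "0 < \<epsilon>" "\<epsilon> \<le> N a / (R b + 1)" and z: "z \<in> S" for \<epsilon> z
    proof (cases "z \<in> K")
      case True
      have "\<epsilon> * R z \<le> \<epsilon> * R b" using b(2)[OF True] \<epsilon> by simp
      also have "\<dots> < \<epsilon> * (R b + 1)" using \<epsilon> by (simp add: algebra_simps)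
      also have "\<dots> \<le> N a" using \<epsilon> Rb by (simp add: field_simps)
      also have "\<dots> \<le> N z" by (rule a(2)[OF True])
      finally show ?thesis .
    qed (use Rneg z \<epsilon> in auto)
    moreover have "N a / (R b + 1) > 0" using Na Rb by simp
    ultimately show ?thesis by blast
  qed
qed

text \<open>Compactness of \<open>S\<close> makes the maximum over the slice at \<open>a\<close>
  negative; uniform continuity keeps the values below half of it for nearby
  \<open>x\<close>.\<close>

lemma negative_on_tube:
  fixes h :: "'a::euclidean_space \<Rightarrow> 'b::euclidean_space \<Rightarrow> real"
  assumes S: "compact S" and h: "continuous_on UNIV (\<lambda>z. h (fst z) (snd z))"
    and neg: "\<And>\<zeta>. \<zeta> \<in> S \<Longrightarrow> h a \<zeta> < 0"
  shows "\<exists>r>0. \<exists>l>0. \<forall>x\<in>cball a r. \<forall>\<zeta>\<in>S. h x \<zeta> \<le> - l"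
proof (cases "S = {}")
  case True
  then show ?thesis by (auto intro!: exI[of _ 1])
next
  case False
  have "continuous_on S (h a)"
    using continuous_on_compose2[OF h, of S "\<lambda>\<zeta>. (a, \<zeta>)"] by (simp add: continuous_on_Pair)
  then obtain m where m: "m \<in> S" "\<And>\<zeta>. \<zeta> \<in> S \<Longrightarrow> h a \<zeta> \<le> h a m"
    using continuous_attains_sup[OF S False] by blast
  define l where "l = - h a m / 2"
  have l: "l > 0" using neg[OF m(1)] by (simp add: l_def)
  have "uniformly_continuous_on (cball a 1 \<times> S) (\<lambda>z. h (fst z) (snd z))"
    using S by (intro compact_uniformly_continuous continuous_on_subset[OF h] compact_Times) auto
  then obtain d where d: "d > 0" "\<And>z z'. \<lbrakk>z \<in> cball a 1 \<times> S; z' \<in> cball a 1 \<times> S; dist z' z < d\<rbrakk> \<Longrightarrow>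
      dist (h (fst z') (snd z')) (h (fst z) (snd z)) < l"
    unfolding uniformly_continuous_on_def using l by metis
  have "h x \<zeta> \<le> - l" if x: "x \<in> cball a (min 1 (d/2))" and \<zeta>: "\<zeta> \<in> S" for x \<zeta>
  proof -
    have "dist (x, \<zeta>) (a, \<zeta>) < d" using x d by (simp add: dist_Pair_Pair dist_commute)
    then have "dist (h x \<zeta>) (h a \<zeta>) < l" using d(2)[of "(a, \<zeta>)" "(x, \<zeta>)"] x \<zeta> by auto
    then show ?thesis using m(2)[OF \<zeta>] by (simp add: dist_real_def l_def)
  qed
  then show ?thesis using d l by (intro exI[of _ "min 1 (d/2)"] conjI exI[of _ l]) auto
qed

lemma homogeneous_le:
  fixes H :: "'a::euclidean_space \<Rightarrow> real"
  assumes hom: "\<And>a \<zeta>. H (a *\<^sub>R \<zeta>) = a\<^sup>2 * H \<zeta>" and unit: "\<And>\<zeta>. \<zeta> \<in> sphere 0 1 \<Longrightarrow> H \<zeta> \<le> K"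
  shows "H \<zeta> \<le> K * (norm \<zeta>)\<^sup>2"
proof (cases "\<zeta> = 0")
  case True
  then show ?thesis using hom[of 0 0] by simp
next
  case False
  have "H \<zeta> = (norm \<zeta>)\<^sup>2 * H ((1 / norm \<zeta>) *\<^sub>R \<zeta>)"
    using hom[of "norm \<zeta>" "(1 / norm \<zeta>) *\<^sub>R \<zeta>"] False by simp
  also have "\<dots> \<le> (norm \<zeta>)\<^sup>2 * K" using False by (intro mult_left_mono unit) auto
  finally show ?thesis by (simp add: mult.commute)
qed

text \<open>An injective linear map in finite dimension is bounded below, and close to
  \<open>a\<close> the linearization error consumes at most half of that bound.\<close>

lemma injective_derivative_lower_bound:
  fixes h :: "'a::euclidean_space \<Rightarrow> 'b::euclidean_space"
  assumes der: "(h has_derivative D) (at a)" and inj: "inj D"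
  obtains k r where "k > 0" "r > 0" "\<And>z. z \<in> cball a r \<Longrightarrow> k * dist z a \<le> norm (h z - h a)"
proof -
  obtain B where B: "B > 0" "\<And>v. B * norm v \<le> norm (D v)"
    using linear_inj_bounded_below_pos[OF has_derivative_linear[OF der] inj] by blast
  obtain d where d: "d > 0" "\<And>z. norm (z - a) < d \<Longrightarrow> norm (h z - h a - D (z - a)) \<le> B / 2 * norm (z - a)"
    using der half_gt_zero[OF B(1)] unfolding has_derivative_at_alt by blast
  have "B / 2 * dist z a \<le> norm (h z - h a)" if "z \<in> cball a (d / 2)" for z
  proof -
    have "norm (z - a) < d" using that d(1) by (simp add: dist_norm norm_minus_commute)
    from d(2)[OF this] B(2)[of "z - a"] norm_triangle_ineq2[of "D (z - a)" "h z - h a"]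
    show ?thesis by (simp add: dist_norm norm_minus_commute)
  qed
  then show thesis by (intro that[of "B / 2" "d / 2"]) (use B(1) d(1) in simp_all)
qed

section \<open>Composition rules for Lipschitz continuity with the constants left implicit\<close>

lemma lipschitz_on_ex_bounded_linear:
  assumes "bounded_linear T" "\<exists>L. L-lipschitz_on S f"
  shows "\<exists>L. L-lipschitz_on S (\<lambda>x. T (f x))"
proof -
  obtain L where L: "L-lipschitz_on S f" using assms(2) by blast
  obtain B where "B-lipschitz_on (f ` S) T" using bounded_linear.lipschitz_boundE[OF assms(1)] by blast
  from lipschitz_on_compose2[OF L this] show ?thesis ..
qed

lemma lipschitz_on_ex_add:
  fixes f h :: "'a::metric_space \<Rightarrow> 'b::real_normed_vector"
  assumes "\<exists>L. L-lipschitz_on S f" "\<exists>L. L-lipschitz_on S h"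
  shows "\<exists>L. L-lipschitz_on S (\<lambda>x. f x + h x)"
proof -
  obtain L L' where "L-lipschitz_on S f" "L'-lipschitz_on S h" using assms by blast
  from lipschitz_on_add[OF this] show ?thesis ..
qed

lemma lipschitz_on_ex_sum:
  fixes f :: "'i \<Rightarrow> 'a::metric_space \<Rightarrow> 'b::real_normed_vector"
  assumes "finite I" "\<And>i. i \<in> I \<Longrightarrow> \<exists>L. L-lipschitz_on S (f i)"
  shows "\<exists>L. L-lipschitz_on S (\<lambda>x. \<Sum>i\<in>I. f i x)"
  using assms
proof (induction I rule: finite_induct)
  case empty
  show ?case by (rule exI[of _ 0]) (simp add: lipschitz_on_constant)
next
  case (insert i I)
  then show ?case by (simp add: lipschitz_on_ex_add)
qed

lemma lipschitz_on_smooth_fst: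
  fixes h :: "'a::euclidean_space \<Rightarrow> 'c::real_normed_vector" and S :: "('a \<times> 'b::euclidean_space) set"
  assumes S: "compact S" "convex S" and h: "smooth h"
  shows "\<exists>L. L-lipschitz_on S (\<lambda>z. h (fst z))"
proof (rule lipschitz_on_C1[OF S])
  fix z :: "'a \<times> 'b"
  have "(fst has_derivative fst) (at z)" by (auto intro!: derivative_eq_intros)
  from has_derivative_compose[OF this smooth_has_derivative[OF h]]
  show "((\<lambda>z. h (fst z)) has_derivative (\<lambda>v. frechet_derivative h (at (fst z)) (fst v))) (at z)" .
next
  fix v :: "'a \<times> 'b"
  show "continuous_on S (\<lambda>z. frechet_derivative h (at (fst z)) (fst v))"
    by (rule continuous_on_compose2[OF smooth_continuous[OF smooth_frechet_derivative[OF h], of UNIV]])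
      (auto intro: continuous_intros)
qed

lemma linear_axis_expansion:
  fixes h :: "real^'n \<Rightarrow> 'b::real_vector"
  assumes "linear h"
  shows "h v = (\<Sum>k\<in>UNIV. (v $ k) *\<^sub>R h (axis k 1))"
proof -
  have "v = (\<Sum>k\<in>UNIV. (v $ k) *\<^sub>R axis k 1)"
    by (simp add: vec_eq_iff axis_def if_distrib cong: if_cong)
  then have "h v = h (\<Sum>k\<in>UNIV. (v $ k) *\<^sub>R axis k 1)" by (rule arg_cong)
  also have "\<dots> = (\<Sum>k\<in>UNIV. (v $ k) *\<^sub>R h (axis k 1))"
    by (simp add: linear_sum[OF assms] linear_scale[OF assms])
  finally show ?thesis .
qed

declare transpose_matrix_vector [simp del]

section \<open>The closed loop\<close>

locale krasovskii_loop =
  fixes f :: "real^'n \<Rightarrow> real^'n"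
    and g :: "real^'n \<Rightarrow> real^'m^'n"
    and gp :: "real^'n \<Rightarrow> real^'n^'k"
    and M :: "real^'n^'n"
    and \<Gamma> :: "real^'n \<Rightarrow> real^'m"
    and xs :: "real^'n" and us :: "real^'m"
    and k1 ki kd :: real
  assumes card_less: "CARD('m) < CARD('n)"
    and smooth_f: "smooth f" and smooth_g: "smooth g"
    and rank_g: "\<And>x. rank (g x) = CARD('m)"
    and M_pd: "positive_definite M"
    and contraction: "\<And>x. negative_definite (M ** jacobian f (at x) + transpose (jacobian f (at x)) ** M)"
    and annihilator: "full_rank_left_annihilator gp g"
    and annihilates_partial: "\<And>x k. gp x ** partial g k x = 0"
    and \<Gamma>_der: "\<And>x. (\<Gamma> has_derivative (\<lambda>h. transpose (M ** g x) *v h)) (at x)"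
    and equilibrium: "f xs + g xs *v us = 0"
    and k1: "k1 > 0" and ki: "ki > 0" and kd: "kd \<ge> 0"
begin

section \<open>Contraction and cancellation by the feedback\<close>

abbreviation J where "J x \<equiv> frechet_derivative f (at x)"
abbreviation Dg where "Dg x \<equiv> frechet_derivative g (at x)"
abbreviation F where "F \<equiv> closed_loop f g M \<Gamma> xs k1 ki kd"

lemmas matrix_vector_mult_minus_left = bounded_bilinear.minus_left[OF bounded_bilinear_matrix_vector_mult]
lemmas matrix_vector_mult_minus_right = bounded_bilinear.minus_right[OF bounded_bilinear_matrix_vector_mult]

lemma M_sym: "transpose M = M" and M_pos: "v \<noteq> 0 \<Longrightarrow> v \<bullet> (M *v v) > 0"
  using M_pd unfolding positive_definite_def by auto

lemma M_inner_commute: "v \<bullet> (M *v w) = w \<bullet> (M *v v)"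
  using inner_transpose_mult[of v M w] by (simp add: M_sym inner_commute)

lemma linear_J: "linear (J x)" and linear_Dg: "linear (Dg x)"
  using smooth_has_derivative[OF smooth_f, of x] smooth_has_derivative[OF smooth_g, of x]
  by (auto intro: has_derivative_linear)

text \<open>Since \<open>M\<close> is symmetric, the quadratic form of the matrix in the contraction
  hypothesis is twice \<open>J x v \<bullet> (M *v v)\<close>.\<close>

lemma J_neg:
  assumes "v \<noteq> 0"
  shows "J x v \<bullet> (M *v v) < 0"
proof -
  let ?A = "jacobian f (at x)"
  have A: "?A *v w = J x w" for w
    using smooth_has_derivative[OF smooth_f, of x] jacobian_works[of f "at x"]
    by (metis differentiableI frechet_derivative_at)
  have "0 < v \<bullet> (- (M ** ?A + transpose ?A ** M) *v v)"
    using contraction[of x] assms unfolding negative_definite_def positive_definite_def by blast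
  also have "- (M ** ?A + transpose ?A ** M) *v v = - (M *v (?A *v v) + transpose ?A *v (M *v v))"
    by (simp add: matrix_vector_mult_minus_left matrix_vector_mult_add_rdistrib matrix_vector_mul_assoc
        del: minus_add_distrib)
  also have "v \<bullet> \<dots> = - (2 * (J x v \<bullet> (M *v v)))"
    by (simp add: inner_add_right inner_diff_right inner_transpose_mult A M_inner_commute[of v])
  finally show ?thesis by simp
qed

lemma inj_g: "inj ((*v) (g x))"
  using rank_g full_rank_injective by blast

text \<open>\<open>Dg x h\<close> is a combination of partial derivatives, each killed by
  \<open>gp x\<close>, and the kernel of \<open>gp x\<close> is the range of
  \<open>g x\<close>.\<close>

lemma Dg_range: "\<exists>c. Dg x h *v u = g x *v c"
proof -
  have exp: "Dg x h = (\<Sum>k\<in>UNIV. (h $ k) *\<^sub>R partial g k x)"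
    unfolding partial_def by (rule linear_axis_expansion[OF linear_Dg])
  have "Dg x h *v u = (\<Sum>k\<in>UNIV. (h $ k) *\<^sub>R (partial g k x *v u))"
    by (simp add: exp bounded_bilinear.sum_left[OF bounded_bilinear_matrix_vector_mult]
        bounded_bilinear.scaleR_left[OF bounded_bilinear_matrix_vector_mult])
  also have "gp x *v \<dots> = 0"
    by (simp add: linear_sum[OF matrix_vector_mul_linear] matrix_vector_mult_scaleR
        matrix_vector_mul_assoc annihilates_partial)
  finally have "gp x *v (Dg x h *v u) = 0" .
  moreover have "rank (gp x) = CARD('n) - CARD('m)" "gp x ** g x = 0"
    using annihilator unfolding full_rank_left_annihilator_def by auto
  ultimately show ?thesis
    using left_annihilator_kernel[OF rank_g _ less_imp_le[OF card_less]] by blast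
qed

lemma gdot_eq: "gdot f g x u = Dg x (xdot f g x u)"
  unfolding gdot_def partial_def by (rule linear_axis_expansion[OF linear_Dg, symmetric])

text \<open>\<open>gdot f g x u *v u\<close> lies in the range of \<open>g x\<close>, on which the
  projection formed by \<open>g x\<close> and the matrix in \<alpha> is the identity.\<close>

lemma alpha_cancels: "g x *v (feedback_alpha f g x u *v u) = - (gdot f g x u *v u)"
proof -
  obtain c where c: "gdot f g x u *v u = g x *v c" using Dg_range gdot_eq by metis
  have "feedback_alpha f g x u *v u =
      - (matrix_inv (transpose (g x) ** g x) *v (transpose (g x) *v (gdot f g x u *v u)))"
    unfolding feedback_alpha_def
    by (simp add: matrix_vector_mult_minus_left matrix_vector_mul_assoc matrix_mul_assoc)
  then show ?thesis
    using normal_equations_projection[OF rank_g, of x c] by (simp add: c matrix_vector_mult_minus_right)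
qed

lemma \<Gamma>'_eq: "transpose (M ** g x) *v h = transpose (g x) *v (M *v h)"
  by (simp add: matrix_transpose_mul M_sym matrix_vector_mul_assoc)

section \<open>Velocity and output-integral coordinates\<close>

text \<open>The pair \<open>(p, q)\<close> of the overview; it vanishes at the equilibrium, and the
  storage function is a quadratic form in it.\<close>

definition \<Phi> :: "(real^'n) \<times> (real^'m) \<Rightarrow> (real^'n) \<times> (real^'m)" where
  "\<Phi> z = (xdot f g (fst z) (snd z), \<Gamma> (fst z) - \<Gamma> xs)"

definition \<Phi>' :: "(real^'n) \<times> (real^'m) \<Rightarrow> (real^'n) \<times> (real^'m) \<Rightarrow> (real^'n) \<times> (real^'m)" where
  "\<Phi>' z h = (J (fst z) (fst h) + (g (fst z) *v snd h + Dg (fst z) (fst h) *v snd z),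
     transpose (g (fst z)) *v (M *v fst h))"

lemma \<Phi>_has_derivative: "(\<Phi> has_derivative \<Phi>' z) (at z)"
proof -
  have fst': "(fst has_derivative fst) (at z)" and snd': "(snd has_derivative snd) (at z)"
    by (auto intro!: derivative_eq_intros)
  have \<Gamma>': "((\<lambda>x. \<Gamma> x - \<Gamma> xs) has_derivative (\<lambda>h. transpose (g x) *v (M *v h))) (at x)" for x
    using has_derivative_diff[OF \<Gamma>_der[of x] has_derivative_const[of "\<Gamma> xs"]] by (simp add: \<Gamma>'_eq)
  note comp = has_derivative_compose[OF fst']
  show ?thesis
    unfolding \<Phi>_def[abs_def] \<Phi>'_def[abs_def] xdot_def
    by (rule has_derivative_Pair has_derivative_add
        bounded_bilinear.FDERIV[OF bounded_bilinear_matrix_vector_mult]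
        comp[OF smooth_has_derivative[OF smooth_f]] comp[OF smooth_has_derivative[OF smooth_g]] snd'
        comp[OF \<Gamma>'])+
qed

text \<open>The product rule contributes \<open>gdot f g x u *v u\<close>, which the \<alpha> term
  cancels. Apart from the coefficients at \<open>x\<close>, only \<open>p\<close>, \<open>q\<close>
  and the input remain.\<close>

lemma \<Phi>'_closed_loop:
  "\<Phi>' z (F z w) =
    (J (fst z) (fst (\<Phi> z)) - g (fst z) *v port_output f g M z
       + (1 / k1) *\<^sub>R (g (fst z) *v (w - kd *\<^sub>R port_output f g M z - ki *\<^sub>R snd (\<Phi> z))),
     port_output f g M z)"
proof (cases z)
  case (Pair x u)
  show ?thesis
    unfolding Pair
    by (simp add: \<Phi>'_def \<Phi>_def vdot_def feedback_beta_def matrix_vector_right_distrib matrix_vector_mult_diff_distrib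
        alpha_cancels gdot_eq matrix_vector_mult_scaleR matrix_vector_mult_minus_right)
qed

section \<open>Storage function and passivity\<close>

text \<open>\<open>W 0\<close> is the storage function; \<open>\<epsilon>\<close> weighs the cross term that makes the decay strict.\<close>

definition W :: "real \<Rightarrow> (real^'n) \<times> (real^'m) \<Rightarrow> real" where
  "W \<epsilon> \<zeta> = k1/2 * (fst \<zeta> \<bullet> (M *v fst \<zeta>)) + ki/2 * (snd \<zeta> \<bullet> snd \<zeta>)
     + \<epsilon> * (fst \<zeta> \<bullet> (M *v (g xs *v snd \<zeta>)))"

definition W' :: "real \<Rightarrow> (real^'n) \<times> (real^'m) \<Rightarrow> (real^'n) \<times> (real^'m) \<Rightarrow> real" where
  "W' \<epsilon> \<zeta> \<eta> = k1 * (fst \<eta> \<bullet> (M *v fst \<zeta>)) + ki * (snd \<eta> \<bullet> snd \<zeta>)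
     + \<epsilon> * (fst \<eta> \<bullet> (M *v (g xs *v snd \<zeta>)) + fst \<zeta> \<bullet> (M *v (g xs *v snd \<eta>)))"

lemma W_has_derivative: "(W \<epsilon> has_derivative W' \<epsilon> \<zeta>) (at \<zeta>)"
proof -
  have "(W \<epsilon> has_derivative (\<lambda>h. k1/2 * (fst \<zeta> \<bullet> (M *v fst h) + fst h \<bullet> (M *v fst \<zeta>))
      + ki/2 * (snd \<zeta> \<bullet> snd h + snd h \<bullet> snd \<zeta>)
      + \<epsilon> * (fst \<zeta> \<bullet> (M *v (g xs *v snd h)) + fst h \<bullet> (M *v (g xs *v snd \<zeta>))))) (at \<zeta>)"
    unfolding W_def[abs_def]
    by (intro has_derivative_add has_derivative_mult_right has_derivative_inner
        has_derivative_fst has_derivative_snd has_derivative_ident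
        bounded_linear.has_derivative[OF matrix_vector_mul_bounded_linear])
  moreover have "fst \<zeta> \<bullet> (M *v fst h) = fst h \<bullet> (M *v fst \<zeta>)" for h :: "(real^'n) \<times> (real^'m)"
    by (rule M_inner_commute)
  ultimately show ?thesis
    unfolding W'_def[abs_def] by (simp add: inner_commute[of "snd \<zeta>"] add.commute[of "fst \<zeta> \<bullet> _"])
qed

lemma W_nonneg: "0 \<le> W 0 \<zeta>"
  using M_pos[of "fst \<zeta>"] k1 ki unfolding W_def by (cases "fst \<zeta> = 0") auto

lemma W\<Phi>_has_derivative: "((\<lambda>z. W \<epsilon> (\<Phi> z)) has_derivative (\<lambda>h. W' \<epsilon> (\<Phi> z) (\<Phi>' z h))) (at z)"
  by (rule has_derivative_compose[OF \<Phi>_has_derivative W_has_derivative])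

lemma port_output_eq: "port_output f g M z = transpose (g (fst z)) *v (M *v fst (\<Phi> z))"
  by (cases z) (simp add: \<Phi>_def)

text \<open>The factor \<open>k1\<close> in the storage function absorbs \<open>1 / k1\<close> in
  \<open>vdot\<close>, and its \<open>ki\<close> term cancels the integral action because
  \<open>q' = y\<close>. Besides the supply rate only the contraction term and the damping
  \<open>- (k1 + kd) * (y \<bullet> y)\<close> remain, neither of them positive.\<close>

lemma dissipation: "W' 0 (\<Phi> z) (\<Phi>' z (F z w)) \<le> port_output f g M z \<bullet> w"
proof -
  define p q y where "p = fst (\<Phi> z)" and "q = snd (\<Phi> z)" and "y = port_output f g M z"
  have gy: "(g (fst z) *v a) \<bullet> (M *v p) = a \<bullet> y" for a
    by (simp add: y_def port_output_eq p_def inner_transpose_mult)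
  have Jp: "J (fst z) p \<bullet> (M *v p) \<le> 0"
    using J_neg[of p] by (cases "p = 0") (auto simp: less_imp_le)
  have "W' 0 (\<Phi> z) (\<Phi>' z (F z w)) =
      k1 * (J (fst z) p \<bullet> (M *v p)) - (k1 + kd) * (y \<bullet> y) + y \<bullet> w"
    unfolding W'_def \<Phi>'_closed_loop p_def[symmetric] q_def[symmetric] y_def[symmetric]
    using k1 by (simp add: inner_add_left inner_diff_left gy inner_commute[of w] inner_commute[of q] algebra_simps)
  moreover have "0 \<le> (k1 + kd) * (y \<bullet> y)" using k1 kd by simp
  moreover have "k1 * (J (fst z) p \<bullet> (M *v p)) \<le> 0" using k1 Jp by (simp add: mult_nonneg_nonpos)
  ultimately show ?thesis unfolding y_def[symmetric] by linarith
qed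

lemma passive_closed_loop: "passive_system F (port_output f g M)"
  unfolding passive_system_def
proof (intro exI[of _ "\<lambda>z. W 0 (\<Phi> z)"] conjI allI impI ballI)
  show "0 \<le> W 0 (\<Phi> z)" for z by (rule W_nonneg)
  show "(\<lambda>z. W 0 (\<Phi> z)) differentiable (at z)" for z
    using W\<Phi>_has_derivative by (rule differentiableI)
  fix T :: real and w z t
  assume "trajectory F {0..<T} w z" "t \<in> {0..<T}"
  then have "(z has_vector_derivative F (z t) (w t)) (at t within {0..<T})"
    unfolding trajectory_def by blast
  from vector_derivative_diff_chain_within[OF this has_derivative_at_withinI[OF W\<Phi>_has_derivative]]
  have "((\<lambda>s. W 0 (\<Phi> (z s))) has_real_derivative W' 0 (\<Phi> (z t)) (\<Phi>' (z t) (F (z t) (w t)))) (at t within {0..<T})"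
    by (simp add: o_def has_real_derivative_iff_has_vector_derivative)
  then show "\<exists>D. ((\<lambda>s. W 0 (\<Phi> (z s))) has_real_derivative D) (at t within {0..<T})
      \<and> D \<le> port_output f g M (z t) \<bullet> w t"
    using dissipation by blast
qed

section \<open>Strict decay near the equilibrium\<close>

text \<open>The field of the unforced loop in the coordinates \<open>\<zeta> = \<Phi> z\<close>, linear in \<open>\<zeta>\<close> for fixed \<open>x\<close>.\<close>

definition \<Theta> :: "real^'n \<Rightarrow> (real^'n) \<times> (real^'m) \<Rightarrow> (real^'n) \<times> (real^'m)" where
  "\<Theta> x \<zeta> = (J x (fst \<zeta>) - g x *v ((1 + kd / k1) *\<^sub>R (transpose (g x) *v (M *v fst \<zeta>)) + (ki / k1) *\<^sub>R snd \<zeta>),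
     transpose (g x) *v (M *v fst \<zeta>))"

lemma \<Phi>'_unforced: "\<Phi>' z (F z 0) = \<Theta> (fst z) (\<Phi> z)"
  unfolding \<Phi>'_closed_loop \<Theta>_def port_output_eq
  by (simp add: matrix_vector_right_distrib matrix_vector_mult_diff_distrib matrix_vector_mult_scaleR
      matrix_vector_mult_minus_right scaleR_diff_right scaleR_add_left scaleR_add_right)

lemma \<Theta>_scaleR: "\<Theta> x (a *\<^sub>R \<zeta>) = a *\<^sub>R \<Theta> x \<zeta>"
  by (simp add: \<Theta>_def linear_scale[OF linear_J] matrix_vector_mult_scaleR matrix_vector_right_distrib
      scaleR_diff_right scaleR_add_right mult.commute)

lemma continuous_\<Theta>: "continuous_on S (\<lambda>z. \<Theta> (fst z) (snd z))"
proof -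
  \<comment> \<open>Smoothness gives continuity of \<open>J\<close> in a fixed direction, so
    \<open>J\<close> is expanded along the axes before the direction varies too.\<close>
  have "continuous_on S (\<lambda>z. J (fst z) (axis k 1))" for k
    by (rule continuous_on_compose2[OF smooth_continuous[OF smooth_frechet_derivative[OF smooth_f], of UNIV]])
      (auto intro: continuous_on_fst continuous_on_id)
  then have "continuous_on S (\<lambda>z. \<Sum>k\<in>UNIV. (fst (snd z) $ k) *\<^sub>R J (fst z) (axis k 1))"
    by (intro continuous_on_sum continuous_on_scaleR continuous_on_component
        continuous_on_fst continuous_on_snd continuous_on_id)
  then have J: "continuous_on S (\<lambda>z. J (fst z) (fst (snd z)))"
    by (simp only: linear_axis_expansion[OF linear_J, symmetric])
  have g: "continuous_on S (\<lambda>z. g (fst z))"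
    by (rule continuous_on_compose2[OF smooth_continuous[OF smooth_g, of UNIV]])
      (auto intro: continuous_on_fst continuous_on_id)
  show ?thesis
    unfolding \<Theta>_def
    by (intro continuous_on_Pair continuous_on_diff continuous_on_add continuous_on_scaleR
        continuous_on_matrix_vector_mult continuous_on_transpose_vector_mult J g
        continuous_on_fst continuous_on_snd continuous_on_const continuous_on_id)
qed

lemma continuous_W':
  assumes "continuous_on S a" "continuous_on S b"
  shows "continuous_on S (\<lambda>z. W' \<epsilon> (a z) (b z))"
  unfolding W'_def
  by (intro continuous_on_add continuous_on_mult continuous_on_inner
        continuous_on_matrix_vector_mult continuous_on_fst continuous_on_snd continuous_on_const assms)

lemma continuous_W: "continuous_on S (W \<epsilon>)"
  unfolding W_def[abs_def]
  by (intro continuous_on_add continuous_on_mult continuous_on_inner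
        continuous_on_matrix_vector_mult continuous_on_fst continuous_on_snd continuous_on_const continuous_on_id)

text \<open>Affine dependence on \<epsilon>, split into a base value and \<epsilon> times a
  correction, which is the shape that \<open>finsler_compact\<close> treats.\<close>

lemma W'_\<epsilon>: "W' \<epsilon> \<zeta> \<eta> = W' 0 \<zeta> \<eta> + \<epsilon> * (W' 1 \<zeta> \<eta> - W' 0 \<zeta> \<eta>)"
  by (simp add: W'_def)

lemma W_\<epsilon>: "W \<epsilon> \<zeta> = W 0 \<zeta> + \<epsilon> * (W 1 \<zeta> - W 0 \<zeta>)"
  by (simp add: W_def)

lemma W'_0_\<Theta>:
  "W' 0 \<zeta> (\<Theta> x \<zeta>) = k1 * (J x (fst \<zeta>) \<bullet> (M *v fst \<zeta>))
     - (k1 + kd) * ((transpose (g x) *v (M *v fst \<zeta>)) \<bullet> (transpose (g x) *v (M *v fst \<zeta>)))"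
proof -
  define y where "y = transpose (g x) *v (M *v fst \<zeta>)"
  have gy: "(g x *v a) \<bullet> (M *v fst \<zeta>) = a \<bullet> y" for a
    by (simp add: y_def inner_transpose_mult)
  show ?thesis
    unfolding W'_def \<Theta>_def y_def[symmetric]
    using k1 by (simp add: inner_add_left inner_diff_left gy inner_commute[of y "snd \<zeta>"] field_simps)
qed

text \<open>For \<open>p\<close> nonzero, contraction gives strict decrease. For
  \<open>p = 0\<close> the storage rate vanishes, but \<open>p'\<close> is
  \<open>- (ki / k1)\<close> times \<open>g xs *v q\<close>, so the cross term falls at
  \<open>ki / k1\<close> times the squared \<open>M\<close>-norm of \<open>g xs *v q\<close>, which
  is positive since \<open>g xs\<close> is injective. The cross term carries \<open>g xs\<close>,
  hence the evaluation at \<open>xs\<close>.\<close>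

lemma strict_decay_on_kernel:
  assumes "\<zeta> \<noteq> 0"
  shows "W' 0 \<zeta> (\<Theta> xs \<zeta>) < 0 \<or> (W' 0 \<zeta> (\<Theta> xs \<zeta>) = 0 \<and> W' 1 \<zeta> (\<Theta> xs \<zeta>) < 0)"
proof (cases "fst \<zeta> = 0")
  case False
  let ?y = "transpose (g xs) *v (M *v fst \<zeta>)"
  have "k1 * (J xs (fst \<zeta>) \<bullet> (M *v fst \<zeta>)) < 0" using k1 J_neg[OF False] by (simp add: mult_pos_neg)
  moreover have "0 \<le> (k1 + kd) * (?y \<bullet> ?y)" using k1 kd by simp
  ultimately show ?thesis unfolding W'_0_\<Theta> by linarith
next
  case True
  then have q: "snd \<zeta> \<noteq> 0" using assms by (metis prod.collapse zero_prod_def)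
  let ?h = "g xs *v snd \<zeta>"
  have "?h \<noteq> 0" using q inj_g by (metis injD matrix_vector_mult_0_right)
  then have "0 < ki / k1 * (?h \<bullet> (M *v ?h))" using M_pos k1 ki by simp
  moreover have "W' 1 \<zeta> (\<Theta> xs \<zeta>) = - (ki / k1 * (?h \<bullet> (M *v ?h)))"
    using True linear_0[OF linear_J] by (simp add: W'_def \<Theta>_def matrix_vector_mult_scaleR)
  moreover have "W' 0 \<zeta> (\<Theta> xs \<zeta>) = 0" using True by (simp add: W'_0_\<Theta>)
  ultimately show ?thesis by simp
qed

text \<open>All three estimates are quadratic in \<zeta>, so they are proved on the unit sphere and
  extended by homogeneity. Finsler's lemma selects \<epsilon> at \<open>xs\<close>, and
  \<open>negative_on_tube\<close> carries the decay over to nearby \<open>x\<close>.\<close>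

lemma strict_lyapunov:
  obtains \<epsilon> c C r l where "c > 0" "C > 0" "r > 0" "l > 0"
    "\<And>\<zeta>. c * (norm \<zeta>)\<^sup>2 \<le> W \<epsilon> \<zeta>" "\<And>\<zeta>. W \<epsilon> \<zeta> \<le> C * (norm \<zeta>)\<^sup>2"
    "\<And>x \<zeta>. x \<in> cball xs r \<Longrightarrow> W' \<epsilon> \<zeta> (\<Theta> x \<zeta>) \<le> - l * (norm \<zeta>)\<^sup>2"
proof -
  let ?S = "sphere (0 :: (real^'n) \<times> (real^'m)) 1"
  have S: "compact ?S" by simp
  have cont\<Theta>: "continuous_on ?S (\<Theta> xs)"
    using continuous_on_compose2[OF continuous_\<Theta>[of UNIV], of ?S "\<lambda>\<zeta>. (xs, \<zeta>)"] by (simp add: continuous_on_Pair)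
  have cW': "continuous_on ?S (\<lambda>\<zeta>. W' \<epsilon> \<zeta> (\<Theta> xs \<zeta>))" for \<epsilon>
    by (intro continuous_W' cont\<Theta> continuous_on_id)
  have S0: "\<zeta> \<noteq> 0" if "\<zeta> \<in> ?S" for \<zeta> using that by auto
  \<comment> \<open>Finsler's lemma with \<open>N\<close> the negated storage rate and
    \<open>R\<close> the rate of the cross term; where \<open>N\<close> vanishes, \<open>R\<close>
    equals \<open>W' 1\<close>, which is negative.\<close>
  have "\<exists>\<epsilon>0>0. \<forall>\<epsilon>. 0 < \<epsilon> \<and> \<epsilon> \<le> \<epsilon>0 \<longrightarrow>
      (\<forall>\<zeta>\<in>?S. \<epsilon> * (W' 1 \<zeta> (\<Theta> xs \<zeta>) - W' 0 \<zeta> (\<Theta> xs \<zeta>)) < - W' 0 \<zeta> (\<Theta> xs \<zeta>))"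
    using strict_decay_on_kernel S0
    by (intro finsler_compact[OF S] continuous_intros cW') force+
  then obtain \<epsilon>1 where \<epsilon>1: "\<epsilon>1 > 0" "\<And>\<epsilon> \<zeta>. \<lbrakk>0 < \<epsilon>; \<epsilon> \<le> \<epsilon>1; \<zeta> \<in> ?S\<rbrakk> \<Longrightarrow>
      \<epsilon> * (W' 1 \<zeta> (\<Theta> xs \<zeta>) - W' 0 \<zeta> (\<Theta> xs \<zeta>)) < - W' 0 \<zeta> (\<Theta> xs \<zeta>)" by blast
  have Wpos: "W 0 \<zeta> > 0" if "\<zeta> \<noteq> 0" for \<zeta>
  proof (cases "fst \<zeta> = 0")
    case True
    then have "snd \<zeta> \<noteq> 0" using that by (metis prod.collapse zero_prod_def)
    then show ?thesis using True ki by (simp add: W_def)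
  next
    case False
    then have "0 < k1 / 2 * (fst \<zeta> \<bullet> (M *v fst \<zeta>))" using M_pos k1 by simp
    moreover have "0 \<le> ki / 2 * (snd \<zeta> \<bullet> snd \<zeta>)" using ki by simp
    ultimately show ?thesis unfolding W_def by linarith
  qed
  \<comment> \<open>\<open>W 0\<close> is already positive on the sphere, so here the lemma only
    says that a small cross term preserves positivity.\<close>
  have "\<exists>\<epsilon>0>0. \<forall>\<epsilon>. 0 < \<epsilon> \<and> \<epsilon> \<le> \<epsilon>0 \<longrightarrow> (\<forall>\<zeta>\<in>?S. \<epsilon> * (W 0 \<zeta> - W 1 \<zeta>) < W 0 \<zeta>)"
    using Wpos S0
    by (intro finsler_compact[OF S] continuous_on_diff continuous_W) force+
  then obtain \<epsilon>2 where \<epsilon>2: "\<epsilon>2 > 0" "\<And>\<epsilon> \<zeta>. \<lbrakk>0 < \<epsilon>; \<epsilon> \<le> \<epsilon>2; \<zeta> \<in> ?S\<rbrakk> \<Longrightarrow>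
      \<epsilon> * (W 0 \<zeta> - W 1 \<zeta>) < W 0 \<zeta>" by blast
  define \<epsilon> where "\<epsilon> = min \<epsilon>1 \<epsilon>2"
  have \<epsilon>: "\<epsilon> > 0" "\<epsilon> \<le> \<epsilon>1" "\<epsilon> \<le> \<epsilon>2" using \<epsilon>1(1) \<epsilon>2(1) by (auto simp: \<epsilon>_def)
  have W'neg: "W' \<epsilon> \<zeta> (\<Theta> xs \<zeta>) < 0" if "\<zeta> \<in> ?S" for \<zeta>
    using \<epsilon>1(2)[OF \<epsilon>(1,2) that] by (subst W'_\<epsilon>) linarith
  have W\<epsilon>pos: "- W \<epsilon> \<zeta> < 0" if "\<zeta> \<in> ?S" for \<zeta>
    using \<epsilon>2(2)[OF \<epsilon>(1,3) that] by (subst W_\<epsilon>) (simp add: algebra_simps)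
  have homW': "W' \<epsilon> (a *\<^sub>R \<zeta>) (\<Theta> x (a *\<^sub>R \<zeta>)) = a\<^sup>2 * W' \<epsilon> \<zeta> (\<Theta> x \<zeta>)" for a x \<zeta>
    by (simp add: \<Theta>_scaleR W'_def matrix_vector_mult_scaleR power2_eq_square algebra_simps)
  have homW: "W \<epsilon> (a *\<^sub>R \<zeta>) = a\<^sup>2 * W \<epsilon> \<zeta>" for a \<zeta>
    by (simp add: W_def matrix_vector_mult_scaleR power2_eq_square algebra_simps)
  have "\<exists>r>0. \<exists>l>0. \<forall>x\<in>cball xs r. \<forall>\<zeta>\<in>?S. W' \<epsilon> \<zeta> (\<Theta> x \<zeta>) \<le> - l"
    by (rule negative_on_tube[where h = "\<lambda>x \<zeta>. W' \<epsilon> \<zeta> (\<Theta> x \<zeta>)", OF S _ W'neg]) (intro continuous_W' continuous_\<Theta> continuous_on_snd continuous_on_id)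
  then obtain r l where rl: "r > 0" "l > 0" "\<And>x \<zeta>. \<lbrakk>x \<in> cball xs r; \<zeta> \<in> ?S\<rbrakk> \<Longrightarrow> W' \<epsilon> \<zeta> (\<Theta> x \<zeta>) \<le> - l"
    by blast
  \<comment> \<open>The function does not vary with \<open>x\<close>; the point is the uniform
    positive lower bound \<open>c\<close> on the sphere.\<close>
  have "\<exists>r>0. \<exists>c>0. \<forall>x\<in>cball xs r. \<forall>\<zeta>\<in>?S. - W \<epsilon> \<zeta> \<le> - c"
    by (rule negative_on_tube[where h = "\<lambda>x \<zeta>. - W \<epsilon> \<zeta>", OF S _ W\<epsilon>pos])
      (auto intro!: continuous_on_minus continuous_on_compose2[OF continuous_W[of UNIV]] continuous_on_snd continuous_on_id)
  then obtain r' c where c: "r' > 0" "c > 0" "\<And>x \<zeta>. \<lbrakk>x \<in> cball xs r'; \<zeta> \<in> ?S\<rbrakk> \<Longrightarrow> - W \<epsilon> \<zeta> \<le> - c" by blast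
  obtain C where C: "C > 0" "\<And>\<zeta>. \<zeta> \<in> ?S \<Longrightarrow> norm (W \<epsilon> \<zeta>) \<le> C"
    using compact_imp_bounded[OF compact_continuous_image[OF continuous_W S]] unfolding bounded_pos by (metis imageI)
  show thesis
  proof
    show "c > 0" "C > 0" "r > 0" "l > 0" by fact+
    fix \<zeta>
    have "- W \<epsilon> \<zeta> \<le> - c * (norm \<zeta>)\<^sup>2"
      using c(3)[of xs] c(1) homW by (intro homogeneous_le[of "\<lambda>\<zeta>. - W \<epsilon> \<zeta>"]) auto
    then show "c * (norm \<zeta>)\<^sup>2 \<le> W \<epsilon> \<zeta>" by simp
    show "W \<epsilon> \<zeta> \<le> C * (norm \<zeta>)\<^sup>2"
    proof (rule homogeneous_le[OF homW])
      show "W \<epsilon> \<zeta> \<le> C" if "\<zeta> \<in> ?S" for \<zeta> using C(2)[OF that] by simp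
    qed
    show "W' \<epsilon> \<zeta> (\<Theta> x \<zeta>) \<le> - l * (norm \<zeta>)\<^sup>2" if "x \<in> cball xs r" for x
      by (rule homogeneous_le[OF homW' rl(3)[OF that]])
  qed
qed

section \<open>Nondegeneracy of the coordinates and regularity of the loop\<close>

lemma inj_\<Phi>': "inj (\<Phi>' z)"
proof -
  have lin: "linear (\<Phi>' z)" using \<Phi>_has_derivative by (rule has_derivative_linear)
  have "h = 0" if h: "\<Phi>' z h = 0" for h
  proof -
    have y: "transpose (g (fst z)) *v (M *v fst h) = 0"
      and p: "J (fst z) (fst h) + (g (fst z) *v snd h + Dg (fst z) (fst h) *v snd z) = 0"
      using h by (auto simp: \<Phi>'_def zero_prod_def)
    obtain c where c: "Dg (fst z) (fst h) *v snd z = g (fst z) *v c" using Dg_range by blast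
    have "J (fst z) (fst h) = - (g (fst z) *v (snd h + c))"
      using p by (simp only: c matrix_vector_right_distrib eq_neg_iff_add_eq_0)
    \<comment> \<open>Pairing with \<open>M *v fst h\<close> turns every term in the range of
      \<open>g\<close> into a pairing with the second component of the derivative, which is 0.
      Contraction then forces \<open>fst h = 0\<close>.\<close>
    then have "J (fst z) (fst h) \<bullet> (M *v fst h) = - ((snd h + c) \<bullet> (transpose (g (fst z)) *v (M *v fst h)))"
      by (simp add: inner_transpose_mult)
    then have "fst h = 0" using y J_neg[of "fst h" "fst z"] by force
    moreover from this have "g (fst z) *v snd h = 0"
      using p linear_0[OF linear_J] linear_0[OF linear_Dg] by simp
    then have "snd h = 0" using inj_g by (metis injD matrix_vector_mult_0_right)
    ultimately show ?thesis by (simp add: prod_eq_iff)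
  qed
  then show ?thesis using linear_injective_0[OF lin] by blast
qed

text \<open>This supplies the existence of trajectories. Linear and bilinear operations on
  \<open>f\<close>, \<open>g\<close>, \<Gamma> and derivatives of \<open>g\<close> give every term
  except \<open>\<alpha> u\<close>, which is recovered from a linear system.\<close>

lemma lipschitz_closed_loop:
  assumes S: "compact S" "convex S"
  shows "\<exists>L. L-lipschitz_on S (\<lambda>z. F z 0)"
proof -
  note bilin = lipschitz_on_bilinear[OF _ S(1)]
  note lip_fst = lipschitz_on_smooth_fst[OF S]
  define p where "p z = xdot f g (fst z) (snd z)" for z
  define y where "y z = transpose (g (fst z)) *v (M *v p z)" for z
  define c where "c z = - (feedback_alpha f g (fst z) (snd z) *v snd z)" for z
  have lg: "\<exists>L. L-lipschitz_on S (\<lambda>z. g (fst z))" by (rule lip_fst[OF smooth_g])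
  have lsnd: "\<exists>L. L-lipschitz_on S snd"
    using lipschitz_on_ex_bounded_linear[OF bounded_linear_snd, of S "\<lambda>z. z"] lipschitz_on_id by auto
  have lp: "\<exists>L. L-lipschitz_on S p"
    unfolding p_def[abs_def] xdot_def
    by (intro lipschitz_on_ex_add bilin[OF bounded_bilinear_matrix_vector_mult] lip_fst smooth_f lg lsnd)
  have ly: "\<exists>L. L-lipschitz_on S y"
    unfolding y_def[abs_def]
    by (intro bilin[OF bounded_bilinear_transpose_vector_mult] lg
        lipschitz_on_ex_bounded_linear[OF matrix_vector_mul_bounded_linear] lp)
  have "\<exists>L. L-lipschitz_on S (\<lambda>z. gdot f g (fst z) (snd z))"
    unfolding gdot_def p_def[symmetric] partial_def
    by (intro lipschitz_on_ex_sum finite bilin[OF bounded_bilinear_scaleR] lip_fst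
        smooth_frechet_derivative smooth_g lipschitz_on_ex_bounded_linear[OF bounded_linear_vec_nth] lp)
  then have "\<exists>L. L-lipschitz_on S (\<lambda>z. gdot f g (fst z) (snd z) *v snd z)"
    by (intro bilin[OF bounded_bilinear_matrix_vector_mult] lsnd)
  \<comment> \<open>By \<open>alpha_cancels\<close>, \<open>c z\<close> solves the system with
    injective matrix \<open>g (fst z)\<close> and right-hand side
    \<open>gdot f g (fst z) (snd z) *v snd z\<close>.\<close>
  then have lc: "\<exists>L. L-lipschitz_on S c"
    by (rule lipschitz_on_linear_solve[OF S(1) lg])
      (auto simp: inj_g c_def matrix_vector_mult_minus_right alpha_cancels)
  have l\<Gamma>: "\<exists>L. L-lipschitz_on S (\<lambda>z. \<Gamma> (fst z))"
  proof (rule lipschitz_on_C1[OF S])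
    fix z :: "(real^'n) \<times> (real^'m)"
    have "(fst has_derivative fst) (at z)" by (auto intro!: derivative_eq_intros)
    from has_derivative_compose[OF this \<Gamma>_der]
    show "((\<lambda>z. \<Gamma> (fst z)) has_derivative (\<lambda>v. transpose (g (fst z)) *v (M *v fst v))) (at z)"
      by (simp add: \<Gamma>'_eq)
  next
    fix v :: "(real^'n) \<times> (real^'m)"
    show "continuous_on S (\<lambda>z. transpose (g (fst z)) *v (M *v fst v))"
      using lg lipschitz_on_continuous_on
      by (intro continuous_on_transpose_vector_mult continuous_on_const) blast
  qed
  have lin: "bounded_linear (\<lambda>v::real^'m. a *\<^sub>R v)" for a by (rule bounded_linear_scaleR_right)
  have "F z 0 = (p z, (-1) *\<^sub>R c z + ((- (1 + kd / k1)) *\<^sub>R y z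
      + ((- (ki / k1)) *\<^sub>R \<Gamma> (fst z) + (ki / k1) *\<^sub>R \<Gamma> xs)))" for z
    by (cases z) (simp add: p_def c_def y_def feedback_beta_def vdot_def algebra_simps)
  moreover have "\<exists>L. L-lipschitz_on S (\<lambda>z. (p z, (-1) *\<^sub>R c z + ((- (1 + kd / k1)) *\<^sub>R y z
      + ((- (ki / k1)) *\<^sub>R \<Gamma> (fst z) + (ki / k1) *\<^sub>R \<Gamma> xs))))"
  proof -
    have "\<exists>L. L-lipschitz_on S (\<lambda>z. (-1) *\<^sub>R c z + ((- (1 + kd / k1)) *\<^sub>R y z
      + ((- (ki / k1)) *\<^sub>R \<Gamma> (fst z) + (ki / k1) *\<^sub>R \<Gamma> xs)))"
      by (intro lipschitz_on_ex_add lipschitz_on_ex_bounded_linear[OF lin] lc ly l\<Gamma>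
          exI[of _ 0] lipschitz_on_constant)
    then obtain L2 where L2: "L2-lipschitz_on S (\<lambda>z. (-1) *\<^sub>R c z + ((- (1 + kd / k1)) *\<^sub>R y z
      + ((- (ki / k1)) *\<^sub>R \<Gamma> (fst z) + (ki / k1) *\<^sub>R \<Gamma> xs)))" ..
    obtain L1 where "L1-lipschitz_on S p" using lp ..
    from lipschitz_on_Pair[OF this L2] show ?thesis ..
  qed
  ultimately show ?thesis by simp
qed

section \<open>Asymptotic stability of the equilibrium\<close>

lemma closed_loop_asymptotically_stable: "asymptotically_stable_equilibrium F (xs, us)"
proof -
  let ?a = "(xs, us)"
  have p0: "xdot f g xs us = 0" using equilibrium by (simp add: xdot_def)
  have \<Phi>0: "\<Phi> ?a = 0" by (simp add: \<Phi>_def p0 zero_prod_def)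
  have F0: "F ?a 0 = 0"
    using p0 linear_0[OF linear_Dg]
    by (simp add: feedback_alpha_def feedback_beta_def vdot_def gdot_eq zero_prod_def matrix_vector_mult_minus_left)
  obtain \<epsilon> c C r l where pos: "c > 0" "C > 0" "r > 0" "l > 0"
    and Wlow: "\<And>\<zeta>. c * (norm \<zeta>)\<^sup>2 \<le> W \<epsilon> \<zeta>" and Wup: "\<And>\<zeta>. W \<epsilon> \<zeta> \<le> C * (norm \<zeta>)\<^sup>2"
    and Wdec: "\<And>x \<zeta>. x \<in> cball xs r \<Longrightarrow> W' \<epsilon> \<zeta> (\<Theta> x \<zeta>) \<le> - l * (norm \<zeta>)\<^sup>2"
    using strict_lyapunov by metis
  obtain k s where ks: "k > 0" "s > 0" "\<And>z. z \<in> cball ?a s \<Longrightarrow> k * dist z ?a \<le> norm (\<Phi> z - \<Phi> ?a)"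
    using injective_derivative_lower_bound[OF \<Phi>_has_derivative inj_\<Phi>'] by metis
  \<comment> \<open>Within \<open>r\<close> the strict decay holds, within \<open>s\<close> the
    lower bound on \<Phi>.\<close>
  define \<rho> where "\<rho> = min r s"
  have \<rho>: "\<rho> > 0" using pos ks by (simp add: \<rho>_def)
  obtain L where L: "L-lipschitz_on (cball ?a \<rho>) (\<lambda>z. F z 0)"
    using lipschitz_closed_loop[of "cball ?a \<rho>"] by auto
  show ?thesis
  proof (rule exponential_lyapunov[where F = F and a = ?a and U = "\<lambda>z. W \<epsilon> (\<Phi> z)" and U' = "\<lambda>z h. W' \<epsilon> (\<Phi> z) (\<Phi>' z h)",
        OF \<rho> L F0 W\<Phi>_has_derivative[of \<epsilon>]])
    show "W \<epsilon> (\<Phi> ?a) = 0" by (simp add: \<Phi>0 W_def)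
    \<comment> \<open>\<open>c\<close> bounds \<open>W \<epsilon>\<close> below by the squared norm
      of \<Phi>, and \<open>k\<close> bounds that norm below by the distance. The rate
      \<open>l / C\<close> compares the decay \<open>l * (norm (\<Phi> z))\<^sup>2\<close> with the
      upper bound on \<open>W \<epsilon>\<close>.\<close>
    show "c * k\<^sup>2 > 0" "l / C > 0" using pos ks by auto
    fix z assume z: "z \<in> cball ?a \<rho>"
    have "(k * dist z ?a)\<^sup>2 \<le> (norm (\<Phi> z))\<^sup>2"
      using ks(3)[of z] z ks(1) by (intro power_mono) (auto simp: \<rho>_def \<Phi>0)
    then have "c * (k * dist z ?a)\<^sup>2 \<le> c * (norm (\<Phi> z))\<^sup>2" using pos by simp
    also have "\<dots> \<le> W \<epsilon> (\<Phi> z)" by (rule Wlow)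
    finally show "c * k\<^sup>2 * (dist z ?a)\<^sup>2 \<le> W \<epsilon> (\<Phi> z)" by (simp add: power_mult_distrib mult.assoc)
    have "dist xs (fst z) \<le> dist ?a z" using dist_fst_le[of ?a z] by simp
    then have "fst z \<in> cball xs r" using z by (simp add: \<rho>_def)
    then have "W' \<epsilon> (\<Phi> z) (\<Phi>' z (F z 0)) \<le> - l * (norm (\<Phi> z))\<^sup>2"
      unfolding \<Phi>'_unforced by (rule Wdec)
    moreover have "l / C * W \<epsilon> (\<Phi> z) \<le> l / C * (C * (norm (\<Phi> z))\<^sup>2)"
      using Wup[of "\<Phi> z"] pos by (intro mult_left_mono) auto
    ultimately show "W' \<epsilon> (\<Phi> z) (\<Phi>' z (F z 0)) \<le> - (l / C) * W \<epsilon> (\<Phi> z)" using pos by simp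
  qed
qed

end

theorem proposition2p13:
  fixes f :: "real^'n \<Rightarrow> real^'n"
    and g :: "real^'n \<Rightarrow> real^'m^'n"
    and gp :: "real^'n \<Rightarrow> real^'n^'k"
    and M :: "real^'n^'n"
    and \<Gamma> :: "real^'n \<Rightarrow> real^'m"
    and xs :: "real^'n" and us :: "real^'m"
    and k1 ki kd :: real
  assumes "CARD('m) < CARD('n)"
    and "smooth f" and "smooth g"
    and "\<And>x. rank (g x) = CARD('m)"
    and A1: "positive_definite M"
      "\<And>x. negative_definite (M ** jacobian f (at x) + transpose (jacobian f (at x)) ** M)"
    and A2: "full_rank_left_annihilator gp g"
      "\<And>x k. gp x ** partial g k x = 0"
    and A3: "columns_integrable (\<lambda>x. M ** g x)"
    and \<Gamma>: "\<And>x. (\<Gamma> has_derivative (\<lambda>h. transpose (M ** g x) *v h)) (at x)"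
    and eq: "f xs + g xs *v us = 0"
    and "k1 > 0" and "ki > 0" and "kd \<ge> 0"
  shows "passive_system (closed_loop f g M \<Gamma> xs k1 ki kd) (port_output f g M) \<and>
     stable_equilibrium (closed_loop f g M \<Gamma> xs k1 ki kd) (xs, us) \<and>
     ((\<forall>z. trajectory (closed_loop f g M \<Gamma> xs k1 ki kd) {0..} (\<lambda>_. 0) z \<and>
            (\<forall>t\<ge>0. port_output f g M (z t) = 0) \<longrightarrow> ((\<lambda>t. fst (z t)) \<longlongrightarrow> xs) at_top)
        \<longrightarrow> asymptotically_stable_equilibrium (closed_loop f g M \<Gamma> xs k1 ki kd) (xs, us))"
proof -
  interpret krasovskii_loop f g gp M \<Gamma> xs us k1 ki kd
    by unfold_locales (use assms in blast)+
  show ?thesis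
    using passive_closed_loop closed_loop_asymptotically_stable
    by (auto simp: asymptotically_stable_equilibrium_def)
qed

end
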